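(* Let $L \subseteq \mathbb{N}$ be an infinite set with lower density $\underline{d}(L) = 0$, and let $t \in \mathbb{N}$. Then $L$-cycles do not have the $\frac{1}{t}$-integral Erd\H{o}s-P\'osa property, even when restricted to planar graphs: there is no function $f:\mathbb{N}\to\mathbb{N}$ such that for all $k \in \mathbb{N}$ and all planar graphs $G$, either $G$ contains a collection of $k$ $L$-cycles such that every vertex of $G$ lies in at most $t$ of these cycles, or there exists $X \subseteq V(G)$ with $|X| \leq f(k)$ such that $G-X$ has no $L$-cycle.
   Context: $\mathbb{N}$ denotes the set of positive integers. Graphs are finite. For $L \subseteq \mathbb{N}$, an $L$-cycle is a cycle whose length (number of edges) lies in $L$. The lower density of $L$ is $\underline{d}(L) := \liminf_{n\to\infty} \frac{|L \cap \{1,\dots,n\}|}{n}$. *)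

theory Defs
  imports "HOL-Analysis.Analysis"
begin

definition lower_density :: "nat set \<Rightarrow> ereal" where
  "lower_density L = liminf (\<lambda>n. ereal (real (card (L \<inter> {1..n})) / real n))"

record 'a ugraph =
  verts :: "'a set"
  edges :: "'a set set"

definition finite_simple_graph :: "'a ugraph \<Rightarrow> bool" where
  "finite_simple_graph G \<longleftrightarrow>
     finite (verts G) \<and> (\<forall>e\<in>edges G. e \<subseteq> verts G \<and> card e = 2)"

definition subgraph_of :: "'a ugraph \<Rightarrow> 'a ugraph \<Rightarrow> bool" where
  "subgraph_of H G \<longleftrightarrow> verts H \<subseteq> verts G \<and> edges H \<subseteq> edges G"

definition delete_verts :: "'a ugraph \<Rightarrow> 'a set \<Rightarrow> 'a ugraph" where
  "delete_verts G X = \<lparr>verts = verts G - X, edges = {e \<in> edges G. e \<inter> X = {}}\<rparr>"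

definition is_cycle :: "'a ugraph \<Rightarrow> bool" where
  "is_cycle C \<longleftrightarrow>
     (\<exists>vs. distinct vs \<and> 3 \<le> length vs \<and> verts C = set vs \<and>
           edges C = {{vs ! i, vs ! (Suc i mod length vs)} | i. i < length vs})"

definition L_cycle_in :: "nat set \<Rightarrow> 'a ugraph \<Rightarrow> 'a ugraph \<Rightarrow> bool" where
  "L_cycle_in L G C \<longleftrightarrow> is_cycle C \<and> subgraph_of C G \<and> card (edges C) \<in> L"

text \<open>A drawing sends vertices to distinct points of the plane and every edge to an arc joining
  the images of its ends; an arc contains no other vertex, and two arcs meet only in the image
  of a common end.\<close>

definition plane_drawing ::
    "'a ugraph \<Rightarrow> ('a \<Rightarrow> real \<times> real) \<Rightarrow> ('a set \<Rightarrow> real \<Rightarrow> real \<times> real) \<Rightarrow> bool" where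
  "plane_drawing G p \<gamma> \<longleftrightarrow>
     inj_on p (verts G) \<and>
     (\<forall>e\<in>edges G. arc (\<gamma> e) \<and> {pathstart (\<gamma> e), pathfinish (\<gamma> e)} = p ` e \<and>
                  path_image (\<gamma> e) \<inter> p ` verts G = p ` e) \<and>
     (\<forall>e\<in>edges G. \<forall>e'\<in>edges G. e \<noteq> e' \<longrightarrow>
        path_image (\<gamma> e) \<inter> path_image (\<gamma> e') = p ` (e \<inter> e'))"

definition planar :: "'a ugraph \<Rightarrow> bool" where
  "planar G \<longleftrightarrow> (\<exists>p \<gamma>. plane_drawing G p \<gamma>)"

text \<open>A collection of \<open>k\<close> cycles is an indexed family, so a cycle may be repeated. Since a cycle
  can occur at most \<open>t\<close> times, a packing of size \<open>t * k\<close> contains \<open>k\<close> distinct cycles; hence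
  insisting on distinct cycles would not change the Erdos-Posa property below.\<close>

definition has_packing :: "nat set \<Rightarrow> nat \<Rightarrow> nat \<Rightarrow> 'a ugraph \<Rightarrow> bool" where
  "has_packing L t k G \<longleftrightarrow>
     (\<exists>C :: nat \<Rightarrow> 'a ugraph.
        (\<forall>i<k. L_cycle_in L G (C i)) \<and>
        (\<forall>v\<in>verts G. card {i. i < k \<and> v \<in> verts (C i)} \<le> t))"

definition has_hitting_set :: "nat set \<Rightarrow> nat \<Rightarrow> 'a ugraph \<Rightarrow> bool" where
  "has_hitting_set L m G \<longleftrightarrow>
     (\<exists>X \<subseteq> verts G. card X \<le> m \<and> \<not> (\<exists>C. L_cycle_in L (delete_verts G X) C))"

text \<open>The \<open>1/t\<close>-integral Erdos-Posa property of \<open>L\<close>-cycles, restricted to a class of graphs.\<close>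

definition erdos_posa :: "nat set \<Rightarrow> nat \<Rightarrow> 'a ugraph set \<Rightarrow> bool" where
  "erdos_posa L t \<G> \<longleftrightarrow>
     (\<exists>f \<in> {1..} \<rightarrow> {1..}. \<forall>k\<ge>1. \<forall>G\<in>\<G>. has_packing L t k G \<or> has_hitting_set L (f k) G)"

end

theory Submission
  imports Defs
begin

text \<open>Fix \<open>m\<close>, let \<open>s = m + 1\<close> and take the \<open>4s \<times> 4s\<close> grid, in which every edge is subdivided into a path of
  length \<open>x\<close>, except that the \<open>s\<close> seam edges, which join rows \<open>s - 1\<close> and \<open>s\<close> in the first \<open>s\<close> columns,
  become paths of length \<open>x + y\<close>. After the deletion of any \<open>m\<close> vertices there is an undamaged
  comb-shaped cycle with exactly \<open>J = 4s\<^sup>2 + 12s\<close> grid edges, one of them in the seam. It fills a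
  constant fraction of the grid. It runs in three columns \<open>c, c + s, c + 3s\<close> with \<open>c < s\<close>, in two outer rows
  \<open>r, r + 3s\<close> with \<open>r < s\<close>, and in any \<open>2s\<close> rows between these for the teeth, so that its length does
  not depend on the choices.

  Choose \<open>l \<in> L\<close> such that \<open>L\<close> is very sparse below \<open>l\<close>, and let \<open>y = l - x J\<close>, so that the comb cycles
  have length \<open>l\<close>. A cycle with \<open>a\<close> grid edges, \<open>b\<close> of them in the seam, has length
  \<open>x a + y b = b l + x (a - J b)\<close>. This is a multiple of \<open>l\<close> or injective in \<open>x\<close>, so for a suitable \<open>x\<close> no
  cycle has a length in \<open>L\<close> below \<open>l\<close>. Since the whole graph has at most \<open>13 l\<close> vertices, it has no
  packing of more than \<open>13 t\<close> \<open>L\<close>-cycles, and no \<open>m\<close> vertices hit all of them.\<close>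

section \<open>Cycles as vertex lists\<close>

fun path_edges :: "'a list \<Rightarrow> 'a set set" where
  "path_edges (a # b # xs) = insert {a, b} (path_edges (b # xs))"
| "path_edges xs = {}"

lemma path_edges_append:
  "path_edges (xs @ a # ys) = path_edges (xs @ [a]) \<union> path_edges (a # ys)"
proof (induction xs)
  case (Cons x xs)
  then show ?case by (cases xs) auto
qed simp

lemma path_edges_conv_nth:
  "path_edges xs = {{xs ! i, xs ! Suc i} | i. Suc i < length xs}"
proof (induction xs rule: path_edges.induct)
  case (1 a b xs)
  have "{{(a # b # xs) ! i, (a # b # xs) ! Suc i} | i. Suc i < length (a # b # xs)}
      = insert {a, b} {{(b # xs) ! i, (b # xs) ! Suc i} | i. Suc i < length (b # xs)}" (is "?A = ?B")
  proof
    show "?A \<subseteq> ?B"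
    proof
      fix e assume "e \<in> ?A"
      then obtain i where i: "e = {(a # b # xs) ! i, (a # b # xs) ! Suc i}" "Suc i < length (a # b # xs)"
        by auto
      then show "e \<in> ?B" by (cases i) auto
    qed
    show "?B \<subseteq> ?A"
    proof
      fix e assume "e \<in> ?B"
      then consider "e = {a, b}" | i where "e = {(b # xs) ! i, (b # xs) ! Suc i}" "Suc i < length (b # xs)"
        by auto
      then show "e \<in> ?A"
      proof cases
        case 1
        then show ?thesis by (auto intro!: exI[of _ 0])
      next
        case 2
        then show ?thesis by (auto intro!: exI[of _ "Suc i"])
      qed
    qed
  qed
  then show ?case using 1 by simp
qed auto

lemma path_edges_subset_set: "e \<in> path_edges xs \<Longrightarrow> e \<subseteq> set xs"
  by (induction xs rule: path_edges.induct) auto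

lemma finite_path_edges: "finite (path_edges xs)"
  by (induction xs rule: path_edges.induct) auto

lemma path_edges_rev: "path_edges (rev xs) = path_edges xs"
proof (induction xs rule: path_edges.induct)
  case (1 a b xs)
  have "path_edges (rev (a # b # xs)) = path_edges (rev (b # xs)) \<union> {{b, a}}"
    using path_edges_append[of "rev xs" b "[a]"] by simp
  then show ?case using 1 by (simp add: insert_commute)
qed auto

lemma path_edges_memE:
  assumes "e \<in> path_edges xs"
  obtains as a b bs where "xs = as @ a # b # bs" "e = {a, b}"
proof -
  obtain i where i: "Suc i < length xs" "e = {xs ! i, xs ! Suc i}"
    using assms by (auto simp: path_edges_conv_nth)
  then have "xs = take i xs @ xs ! i # xs ! Suc i # drop (Suc (Suc i)) xs"
    by (metis Cons_nth_drop_Suc Suc_lessD append_take_drop_id)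
  with i that show ?thesis by blast
qed

lemma card_path_edges:
  assumes "distinct xs"
  shows "card (path_edges xs) = length xs - 1"
  using assms
proof (induction xs rule: path_edges.induct)
  case (1 a b xs)
  then have "{a, b} \<notin> path_edges (b # xs)"
    using path_edges_subset_set[of "{a, b}" "b # xs"] by auto
  with 1 show ?case by (simp add: finite_path_edges)
qed auto

text \<open>Repeating the head at the end turns the closed walk into a path, so that rotations
  follow from the append law for \<open>path_edges\<close> without modular indices.\<close>

definition cycle_edges :: "'a list \<Rightarrow> 'a set set" where
  "cycle_edges vs = path_edges (vs @ [hd vs])"

lemma cycle_edges_Cons: "cycle_edges (a # xs) = path_edges (a # xs) \<union> {{last (a # xs), a}}"
proof -
  have "cycle_edges (a # xs) = path_edges (butlast (a # xs) @ last (a # xs) # [a])"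
    unfolding cycle_edges_def
    by (metis append.assoc append_Cons append_Nil append_butlast_last_id list.distinct(1) list.sel(1))
  also have "\<dots> = path_edges (a # xs) \<union> {{last (a # xs), a}}"
    by (subst path_edges_append) (simp del: butlast.simps last.simps)
  finally show ?thesis .
qed

lemma cycle_edges_conv_nth:
  assumes "vs \<noteq> []"
  shows "cycle_edges vs = {{vs ! i, vs ! (Suc i mod length vs)} | i. i < length vs}"
proof -
  have "(vs @ [hd vs]) ! Suc i = vs ! (Suc i mod length vs)" if "i < length vs" for i
    using that assms by (cases "Suc i = length vs") (auto simp: nth_append hd_conv_nth)
  moreover have "(vs @ [hd vs]) ! i = vs ! i" if "i < length vs" for i
    using that by (simp add: nth_append)
  ultimately have eq: "{(vs @ [hd vs]) ! i, (vs @ [hd vs]) ! Suc i} = {vs ! i, vs ! (Suc i mod length vs)}"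
    if "i < length vs" for i
    using that by presburger
  have "{i. Suc i < length (vs @ [hd vs])} = {i. i < length vs}"
    by simp
  moreover have "(\<lambda>i. {(vs @ [hd vs]) ! i, (vs @ [hd vs]) ! Suc i}) ` {i. i < length vs}
      = (\<lambda>i. {vs ! i, vs ! (Suc i mod length vs)}) ` {i. i < length vs}"
    by (rule image_cong[OF refl]) (rule eq, simp)
  ultimately show ?thesis
    unfolding cycle_edges_def path_edges_conv_nth setcompr_eq_image by (rule ssubst)
qed

lemma is_cycle_iff:
  "is_cycle C \<longleftrightarrow> (\<exists>vs. distinct vs \<and> 3 \<le> length vs \<and> verts C = set vs \<and> edges C = cycle_edges vs)"
proof -
  have eq: "{{vs ! i, vs ! (Suc i mod length vs)} | i. i < length vs} = cycle_edges vs"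
    if "3 \<le> length vs" for vs :: "'a list"
    by (rule cycle_edges_conv_nth[symmetric]) (use that in auto)
  show ?thesis unfolding is_cycle_def by (intro ex_cong1 conj_cong refl) (simp only: eq)
qed

lemma cycle_edges_rotate:
  "cycle_edges (xs @ ys) = cycle_edges (ys @ xs)"
proof (cases "xs = [] \<or> ys = []")
  case False
  then obtain a xs' b ys' where eq: "xs = a # xs'" "ys = b # ys'" by (meson neq_Nil_conv)
  have "cycle_edges (xs @ ys) = path_edges (xs @ [b]) \<union> path_edges (ys @ [a])"
    using path_edges_append[of xs b "ys' @ [a]"] by (simp add: eq cycle_edges_def)
  moreover have "cycle_edges (ys @ xs) = path_edges (ys @ [a]) \<union> path_edges (xs @ [b])"
    using path_edges_append[of ys a "xs' @ [b]"] by (simp add: eq cycle_edges_def)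
  ultimately show ?thesis by blast
qed auto

text \<open>The closing edge is new: the only path edge at the head is the first one, and with at
  least three vertices the last vertex differs from the second.\<close>

lemma card_cycle_edges:
  assumes "distinct vs" "3 \<le> length vs"
  shows "card (cycle_edges vs) = length vs"
proof -
  obtain a b c xs where vs: "vs = a # b # c # xs"
    using assms(2) by (metis Suc_le_length_iff numeral_3_eq_3)
  have "{last vs, a} \<noteq> {a, b}"
    using assms(1) last_in_set[of "c # xs"] by (auto simp: vs doubleton_eq_iff)
  moreover have "{last vs, a} \<notin> path_edges (b # c # xs)"
    using path_edges_subset_set[of "{last vs, a}" "b # c # xs"] assms(1) by (auto simp: vs)
  ultimately have "{last vs, a} \<notin> path_edges vs" by (simp add: vs)
  moreover have "cycle_edges vs = insert {last vs, a} (path_edges vs)"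
    by (simp only: vs cycle_edges_Cons) simp
  ultimately show ?thesis
    using card_path_edges[OF assms(1)] assms(2) by (simp add: finite_path_edges)
qed

lemma cycle_rotate_to_vertex:
  assumes "is_cycle C" "z \<in> verts C"
  obtains vs where "distinct (z # vs)" "2 \<le> length vs" "verts C = set (z # vs)"
    "edges C = cycle_edges (z # vs)"
proof -
  obtain us where us: "distinct us" "3 \<le> length us" "verts C = set us" "edges C = cycle_edges us"
    using assms(1) by (auto simp: is_cycle_iff)
  obtain as bs where split: "us = as @ z # bs" using us(3) assms(2) by (metis split_list)
  show ?thesis
  proof (rule that[of "bs @ as"])
    show "edges C = cycle_edges (z # bs @ as)"
      using us(4) cycle_edges_rotate[of as "z # bs"] by (simp add: split)
  qed (use us split in auto)
qed

text \<open>With the given edge in closing position, the rest of the cycle is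
  \<open>path_edges vs\<close>, and a new vertex is inserted into that edge by consing it onto the
  list.\<close>

lemma cycle_rotate_to_edge:
  assumes "is_cycle C" "e \<in> edges C"
  obtains vs where "distinct vs" "3 \<le> length vs" "verts C = set vs"
    "edges C = cycle_edges vs" "e = {last vs, hd vs}"
proof -
  obtain us where us: "distinct us" "3 \<le> length us" "verts C = set us" "edges C = cycle_edges us"
    using assms(1) by (auto simp: is_cycle_iff)
  obtain as a b bs where split: "us @ [hd us] = as @ a # b # bs" "e = {a, b}"
    using assms(2) us(4) unfolding cycle_edges_def by (auto elim: path_edges_memE)
  \<comment> \<open>If nothing follows the edge in the closed list, it is the closing edge already;
    otherwise the list is rotated to start at the second end of the edge.\<close>
  show ?thesis
  proof (cases bs rule: rev_cases)
    case Nil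
    then have "us @ [hd us] = (as @ [a]) @ [b]"
      using split(1) by (simp only: append.assoc append.simps)
    then have "us = as @ [a]" and hd: "hd us = b" by (metis butlast_snoc, metis last_snoc)
    then have "e = {last us, hd us}" unfolding hd split(2) by simp
    then show ?thesis using that[of us] us by blast
  next
    case (snoc bs' c)
    then have "us = as @ a # b # bs'" using split by simp
    then have "us = (as @ [a]) @ b # bs'" by simp
    moreover from this have "edges C = cycle_edges (b # bs' @ as @ [a])"
      using us(4) cycle_edges_rotate[of "as @ [a]" "b # bs'"] by simp
    ultimately show ?thesis using that[of "b # bs' @ as @ [a]"] us split by auto
  qed
qed

lemma is_cycle_card:
  assumes "is_cycle C"
  shows "card (edges C) = card (verts C)" "edges C \<noteq> {}"
proof -
  obtain vs where vs: "distinct vs" "3 \<le> length vs" "verts C = set vs" "edges C = cycle_edges vs"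
    using assms by (auto simp: is_cycle_iff)
  show "card (edges C) = card (verts C)"
    using card_cycle_edges[OF vs(1,2)] distinct_card[OF vs(1)] vs by simp
  then show "edges C \<noteq> {}" using vs distinct_card[OF vs(1)] by auto
qed

lemma is_cycle_edge_subset:
  assumes "is_cycle C" "e \<in> edges C"
  shows "e \<subseteq> verts C"
proof -
  obtain vs where vs: "3 \<le> length vs" "verts C = set vs" "edges C = cycle_edges vs"
    using assms(1) by (auto simp: is_cycle_iff)
  have "vs \<noteq> []" using vs(1) by auto
  then have "set (vs @ [hd vs]) = set vs" by auto
  then show ?thesis
    using path_edges_subset_set[of e "vs @ [hd vs]"] assms(2) vs unfolding cycle_edges_def by metis
qed

section \<open>Subdivisions\<close>

lemma finite_edges: "finite_simple_graph G \<Longrightarrow> finite (edges G)"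
  by (rule finite_subset[of "edges G" "Pow (verts G)"]) (auto simp: finite_simple_graph_def)

lemma cycle_subgraph_delete_verts:
  assumes "is_cycle C"
  shows "subgraph_of C (delete_verts G X) \<longleftrightarrow> subgraph_of C G \<and> verts C \<inter> X = {}"
  using is_cycle_edge_subset[OF assms] unfolding subgraph_of_def delete_verts_def by fastforce

text \<open>Weights are realised one unit at a time, by iterating this single subdivision with a
  fresh vertex \<open>z\<close>.\<close>

locale edge_subdivision =
  fixes G :: "'a ugraph" and u v z :: 'a
  assumes simple: "finite_simple_graph G" and uv: "{u, v} \<in> edges G" and z: "z \<notin> verts G"
begin

definition subdivided :: "'a ugraph" where
  "subdivided = \<lparr>verts = insert z (verts G), edges = insert {u, z} (insert {z, v} (edges G - {{u, v}}))\<rparr>"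

lemma edge_subset: "e \<in> edges G \<Longrightarrow> e \<subseteq> verts G"
  using simple by (auto simp: finite_simple_graph_def)

lemma u_neq_v: "u \<noteq> v"
  using simple uv by (fastforce simp: finite_simple_graph_def)

lemma ends: "u \<in> verts G" "v \<in> verts G" "u \<noteq> z" "v \<noteq> z"
  using edge_subset[OF uv] z by auto

lemma z_notin_edge: "e \<in> edges G \<Longrightarrow> z \<notin> e"
  using edge_subset z by blast

lemma new_edges: "{u, z} \<notin> edges G" "{z, v} \<notin> edges G" "{u, z} \<noteq> {z, v}"
  using z_notin_edge u_neq_v by (auto simp: doubleton_eq_iff)

lemma simple_subdivided: "finite_simple_graph subdivided"
  using simple ends unfolding finite_simple_graph_def subdivided_def by auto

text \<open>The only neighbours of \<open>z\<close> are \<open>u\<close> and \<open>v\<close>, so a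
  cycle through \<open>z\<close> passes both of them next to \<open>z\<close> and can take the old
  edge instead. Lengths are weighted because the lemma serves every stage of an iteration in which
  the weights change.\<close>

lemma contract_cycle:
  fixes w w' :: "'a set \<Rightarrow> nat"
  assumes w: "w' {u, z} + w' {z, v} = w {u, v}" "\<And>e. e \<in> edges G - {{u, v}} \<Longrightarrow> w' e = w e"
    and C: "is_cycle C" "subgraph_of C subdivided"
  shows "\<exists>D. is_cycle D \<and> subgraph_of D G \<and> sum w (edges D) = sum w' (edges C)"
proof (cases "z \<in> verts C")
  case False
  have sub: "edges C \<subseteq> edges G - {{u, v}}"
    using C is_cycle_edge_subset[OF C(1)] False unfolding subgraph_of_def subdivided_def by fastforce
  then have "sum w (edges C) = sum w' (edges C)"
    by (intro sum.cong refl, subst w(2)) auto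
  moreover have "subgraph_of C G"
    using C(2) False sub unfolding subgraph_of_def subdivided_def by auto
  ultimately show ?thesis using C(1) by blast
next
  case True
  obtain vs where vs: "distinct (z # vs)" "2 \<le> length vs" "verts C = set (z # vs)"
    "edges C = cycle_edges (z # vs)"
    using cycle_rotate_to_vertex[OF C(1) True] .
  obtain a c xs where vs_eq: "vs = a # c # xs"
    using vs(2) by (metis Suc_le_length_iff numeral_2_eq_2)
  define b where "b = last vs"
  have ab: "a \<noteq> b" "a \<noteq> z" "b \<noteq> z"
    using vs(1) last_in_set[of vs] last_in_set[of "c # xs"] by (auto simp: b_def vs_eq)
  have C_edges: "edges C = insert {z, a} (insert {b, z} (path_edges vs))"
    unfolding vs(4) cycle_edges_Cons by (auto simp: vs_eq b_def)
  have sub: "edges C \<subseteq> edges subdivided"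
    using C(2) by (simp add: subgraph_of_def)
  have "{z, a} \<in> edges subdivided" "{b, z} \<in> edges subdivided"
    using sub C_edges by auto
  then have "a \<in> {u, v}" "b \<in> {u, v}"
    using z_notin_edge[of "{z, a}"] z_notin_edge[of "{b, z}"] ab
    by (auto simp: subdivided_def doubleton_eq_iff)
  then have ab_eq: "{b, a} = {u, v}" and new_eq: "{{z, a}, {b, z}} = {{u, z}, {z, v}}"
    using ab(1) by (auto simp: insert_commute)
  have z_path: "e \<in> path_edges vs \<Longrightarrow> z \<notin> e" for e
    using path_edges_subset_set[of e vs] vs(1) by auto
  have path_sub: "path_edges vs \<subseteq> edges G - {{u, v}}"
  proof
    fix e assume e: "e \<in> path_edges vs"
    then have "e \<in> edges subdivided" "z \<notin> e"
      using sub C_edges z_path by auto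
    then show "e \<in> edges G - {{u, v}}"
      unfolding subdivided_def by auto
  qed
  \<comment> \<open>A triangle through \<open>z\<close> would use the edge \<open>{u, v}\<close>,
    which the subdivision has removed; hence at least three vertices remain when \<open>z\<close> is
    dropped.\<close>
  have "xs \<noteq> []"
  proof
    assume "xs = []"
    then have "{a, b} \<in> path_edges vs" by (simp add: vs_eq b_def)
    then show False using path_sub ab_eq by (auto simp: insert_commute)
  qed
  define D where "D = \<lparr>verts = set vs, edges = cycle_edges vs\<rparr>"
  have "is_cycle D"
    using vs(1) \<open>xs \<noteq> []\<close> unfolding is_cycle_iff D_def
    by (intro exI[of _ vs]) (auto simp: vs_eq Suc_le_eq)
  moreover have D_edges: "edges D = insert {u, v} (path_edges vs)"
    unfolding D_def by (simp add: vs_eq cycle_edges_Cons ab_eq b_def flip: ab_eq)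
  moreover have "verts D \<subseteq> verts G"
    using C(2) vs(1,3) by (auto simp: D_def subgraph_of_def subdivided_def)
  ultimately have D: "is_cycle D" "subgraph_of D G"
    using path_sub uv by (auto simp: subgraph_of_def)
  have "edges C = {{z, a}, {b, z}} \<union> path_edges vs"
    using C_edges by auto
  then have "edges C = insert {u, z} (insert {z, v} (path_edges vs))"
    unfolding new_eq by auto
  moreover have "{u, z} \<notin> path_edges vs" "{z, v} \<notin> path_edges vs"
    using z_path by auto
  ultimately have "sum w' (edges C) = w {u, v} + sum w' (path_edges vs)"
    using w(1) new_edges(3) by (simp add: finite_path_edges)
  also have "sum w' (path_edges vs) = sum w (path_edges vs)"
    using path_sub w(2) by (intro sum.cong) auto
  also have "w {u, v} + sum w (path_edges vs) = sum w (edges D)"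
    using path_sub by (subst D_edges, subst sum.insert) (auto simp: finite_path_edges)
  finally show ?thesis using D by auto
qed

text \<open>The last two clauses serve the transfer of deleted sets: the new cycle meets
  \<open>z\<close> only if the old one meets \<open>u\<close>, so deleting \<open>u\<close> from
  \<open>G\<close> can stand in for deleting \<open>z\<close>.\<close>

lemma expand_cycle:
  fixes w w' :: "'a set \<Rightarrow> nat"
  assumes w: "w' {u, z} + w' {z, v} = w {u, v}" "\<And>e. e \<in> edges G - {{u, v}} \<Longrightarrow> w' e = w e"
    and C: "is_cycle C" "subgraph_of C G"
  shows "\<exists>D. is_cycle D \<and> subgraph_of D subdivided \<and> sum w' (edges D) = sum w (edges C) \<and>
    verts D \<subseteq> insert z (verts C) \<and> (z \<in> verts D \<longrightarrow> u \<in> verts C)"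
proof (cases "{u, v} \<in> edges C")
  case False
  then have "sum w' (edges C) = sum w (edges C)"
    using C w(2) by (intro sum.cong) (auto simp: subgraph_of_def)
  moreover have "subgraph_of C subdivided" "z \<notin> verts C"
    using False C z by (auto simp: subgraph_of_def subdivided_def)
  ultimately show ?thesis using C by blast
next
  case True
  obtain vs where vs: "distinct vs" "3 \<le> length vs" "verts C = set vs"
    "edges C = cycle_edges vs" "{u, v} = {last vs, hd vs}"
    using cycle_rotate_to_edge[OF C(1) True] .
  obtain a b xs where vs_eq: "vs = a # b # xs" "xs \<noteq> []"
    using vs(2) by (metis Suc_le_length_iff numeral_3_eq_3 list.distinct(1))
  have z_vs: "z \<notin> set vs"
    using C(2) vs(3) z by (auto simp: subgraph_of_def)
  \<comment> \<open>The closing edge does not occur a second time, since otherwise the cycle would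
    have one edge too few.\<close>
  have uv_path: "{u, v} \<notin> path_edges vs"
  proof
    assume "{u, v} \<in> path_edges vs"
    then have "edges C = path_edges vs"
      using vs(4,5) by (auto simp: vs_eq cycle_edges_Cons)
    then show False
      using card_path_edges[OF vs(1)] card_cycle_edges[OF vs(1,2)] vs(4) by (simp add: vs_eq)
  qed
  define D where "D = \<lparr>verts = set (z # vs), edges = cycle_edges (z # vs)\<rparr>"
  have "is_cycle D"
    using vs(1,2) z_vs unfolding is_cycle_iff D_def by (intro exI[of _ "z # vs"]) auto
  have new_eq: "{{z, hd vs}, {last vs, z}} = {{u, z}, {z, v}}"
    using vs(5) by (auto simp: doubleton_eq_iff)
  have "edges D = {{z, hd vs}, {last vs, z}} \<union> path_edges vs"
    by (auto simp: D_def cycle_edges_Cons vs_eq)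
  then have D_edges: "edges D = insert {u, z} (insert {z, v} (path_edges vs))"
    unfolding new_eq by auto
  have C_edges: "edges C = insert {u, v} (path_edges vs)"
    using vs(4,5) by (auto simp: vs_eq cycle_edges_Cons)
  have "{u, z} \<notin> path_edges vs" "{z, v} \<notin> path_edges vs"
    using path_edges_subset_set[of _ vs] z_vs by auto
  then have "sum w' (edges D) = w {u, v} + sum w' (path_edges vs)"
    using w(1) new_edges(3) by (simp add: D_edges finite_path_edges)
  also have "sum w' (path_edges vs) = sum w (path_edges vs)"
    using C(2) uv_path C_edges w(2) by (intro sum.cong) (auto simp: subgraph_of_def)
  also have "w {u, v} + sum w (path_edges vs) = sum w (edges C)"
    using uv_path by (simp add: C_edges finite_path_edges)
  finally have "sum w' (edges D) = sum w (edges C)" .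
  moreover have "subgraph_of D subdivided"
  proof -
    have "path_edges vs \<subseteq> edges G - {{u, v}}"
      using C(2) C_edges uv_path by (auto simp: subgraph_of_def)
    moreover have "verts D \<subseteq> insert z (verts G)"
      using C(2) vs(3) by (auto simp: subgraph_of_def D_def)
    ultimately show ?thesis by (auto simp: subgraph_of_def D_edges subdivided_def)
  qed
  moreover have "u \<in> verts C"
    using is_cycle_edge_subset[OF C(1) True] by simp
  ultimately show ?thesis
    using \<open>is_cycle D\<close> vs(3) by (intro exI[of _ D]) (auto simp: D_def)
qed

text \<open>The new vertex is placed at parameter 1/2 of the arc of the old edge, and the two halves
  become the arcs of the new edges. As the arc is injective, the halves meet only in that
  point.\<close>

lemma planar_subdivided:
  assumes "planar G"
  shows "planar subdivided"
proof -
  obtain p \<gamma> where "plane_drawing G p \<gamma>"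
    using assms by (auto simp: planar_def)
  then have inj: "inj_on p (verts G)"
    and arc: "\<And>e. e \<in> edges G \<Longrightarrow> arc (\<gamma> e)"
    and ends_eq: "\<And>e. e \<in> edges G \<Longrightarrow> {pathstart (\<gamma> e), pathfinish (\<gamma> e)} = p ` e"
    and verts_int: "\<And>e. e \<in> edges G \<Longrightarrow> path_image (\<gamma> e) \<inter> p ` verts G = p ` e"
    and edges_int: "\<And>e f. e \<in> edges G \<Longrightarrow> f \<in> edges G \<Longrightarrow> e \<noteq> f \<Longrightarrow>
        path_image (\<gamma> e) \<inter> path_image (\<gamma> f) = p ` (e \<inter> f)"
    by (auto simp: plane_drawing_def)
  \<comment> \<open>The drawing fixes only the unordered pair of end points; \<open>h\<close> is the
    arc oriented from \<open>u\<close> to \<open>v\<close>.\<close>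
  define h where "h = (if pathstart (\<gamma> {u, v}) = p u then \<gamma> {u, v} else reversepath (\<gamma> {u, v}))"
  have h_arc: "arc h" and h_image: "path_image h = path_image (\<gamma> {u, v})"
    using arc[OF uv] by (auto simp: h_def arc_reversepath)
  have p_uv: "p u \<noteq> p v"
    using inj ends u_neq_v by (auto dest: inj_onD)
  have h_ends: "h 0 = p u" "h 1 = p v"
    using ends_eq[OF uv] p_uv
    by (auto simp: h_def pathstart_def pathfinish_def reversepath_def doubleton_eq_iff)
  have h_inj: "inj_on h {0..1}"
    using h_arc by (simp add: arc_def)
  have img: "path_image h = h ` {0..1}"
    by (simp add: path_image_def)
  define m where "m = h (1/2)"
  have m_neq: "m \<noteq> p u" "m \<noteq> p v"
    using inj_onD[OF h_inj, of "1/2" 0] inj_onD[OF h_inj, of "1/2" 1] by (auto simp: m_def h_ends)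
  have m_img: "m \<in> path_image h" by (auto simp: m_def img)
  have m_verts: "m \<notin> p ` verts G"
    using verts_int[OF uv] m_img m_neq by (auto simp: h_image)
  define h1 h2 where "h1 = subpath 0 (1/2) h" and "h2 = subpath (1/2) 1 h"
  have h1_img: "path_image h1 = h ` {0..1/2}" and h2_img: "path_image h2 = h ` {1/2..1}"
    by (auto simp: h1_def h2_def path_image_subpath)
  have h1_sub: "path_image h1 \<subseteq> path_image h" and h2_sub: "path_image h2 \<subseteq> path_image h"
    by (auto simp: h1_img h2_img img)
  have v_h1: "p v \<notin> path_image h1"
  proof
    assume "p v \<in> path_image h1"
    then obtain x where "x \<in> {0..1/2}" "h x = h 1" by (auto simp: h1_img h_ends)
    then show False using inj_onD[OF h_inj, of x 1] by auto
  qed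
  have u_h2: "p u \<notin> path_image h2"
  proof
    assume "p u \<in> path_image h2"
    then obtain x where "x \<in> {1/2..1}" "h x = h 0" by (auto simp: h2_img h_ends)
    then show False using inj_onD[OF h_inj, of x 0] by auto
  qed
  have mem: "p u \<in> path_image h1" "m \<in> path_image h1" "p v \<in> path_image h2" "m \<in> path_image h2"
    by (auto simp: h1_img h2_img m_def simp flip: h_ends)
  have h12: "path_image h1 \<inter> path_image h2 = {m}"
  proof -
    have "path_image h1 \<inter> path_image h2 \<subseteq> {m}"
    proof
      fix q assume "q \<in> path_image h1 \<inter> path_image h2"
      then obtain x y where "x \<in> {0..1/2}" "y \<in> {1/2..1}" "q = h x" "h x = h y"
        by (auto simp: h1_img h2_img)
      moreover from this have "x = y" using inj_onD[OF h_inj, of x y] by auto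
      ultimately have "x = 1/2" "q = h x" by auto
      then show "q \<in> {m}" unfolding m_def by (metis singletonI)
    qed
    with mem show ?thesis by blast
  qed
  have h1_arc: "arc h1" and h2_arc: "arc h2"
    using h_arc by (auto simp: h1_def h2_def intro!: arc_subpath_arc)
  have h_ends': "pathstart h1 = p u" "pathfinish h1 = m" "pathstart h2 = m" "pathfinish h2 = p v"
    by (auto simp: h1_def h2_def m_def h_ends)
  have h_verts: "path_image h \<inter> p ` verts G = {p u, p v}"
    using verts_int[OF uv] by (simp add: h_image)
  have h_f: "path_image h \<inter> path_image (\<gamma> f) = p ` ({u, v} \<inter> f)" if "f \<in> edges G - {{u, v}}" for f
    using edges_int[of "{u, v}" f] uv that by (auto simp: h_image)
  have m_f: "m \<notin> path_image (\<gamma> f)" if "f \<in> edges G - {{u, v}}" for f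
    using h_f[OF that] m_img m_verts ends by auto
  define p' where "p' = p(z := m)"
  define \<gamma>' where "\<gamma>' = \<gamma>({u, z} := h1, {z, v} := h2)"
  have p'_f: "p' ` f = p ` f" if "f \<subseteq> verts G" for f
    using that z by (auto simp: p'_def)
  have p'_ends: "p' u = p u" "p' v = p v" "p' z = m"
    using ends by (auto simp: p'_def)
  have p'_verts: "p' ` verts subdivided = insert m (p ` verts G)"
    using p'_f[of "verts G"] by (auto simp: subdivided_def p'_ends)
  have \<gamma>'_new: "\<gamma>' {u, z} = h1" "\<gamma>' {z, v} = h2"
    using new_edges by (auto simp: \<gamma>'_def)
  have \<gamma>'_f: "\<gamma>' f = \<gamma> f" if "f \<in> edges G" for f
    using that new_edges by (auto simp: \<gamma>'_def)
  \<comment> \<open>The whole old arc meets the arc of \<open>f\<close> only in images of common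
    ends; each half contains just one of \<open>p u\<close> and \<open>p v\<close>, and
    \<open>z\<close> lies on no old edge.\<close>
  have new_f: "path_image h1 \<inter> path_image (\<gamma> f) = p' ` ({u, z} \<inter> f)"
    "path_image h2 \<inter> path_image (\<gamma> f) = p' ` ({z, v} \<inter> f)" if f: "f \<in> edges G - {{u, v}}" for f
  proof -
    have sub: "f \<subseteq> verts G" "z \<notin> f" using f edge_subset z_notin_edge by auto
    have "path_image h1 \<inter> path_image (\<gamma> f) = path_image h1 \<inter> p ` ({u, v} \<inter> f)"
      using h_f[OF f] h1_sub by blast
    also have "\<dots> = p' ` ({u, z} \<inter> f)"
      using v_h1 mem(1) sub p'_ends by auto
    finally show "path_image h1 \<inter> path_image (\<gamma> f) = p' ` ({u, z} \<inter> f)" .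
    have "path_image h2 \<inter> path_image (\<gamma> f) = path_image h2 \<inter> p ` ({u, v} \<inter> f)"
      using h_f[OF f] h2_sub by blast
    also have "\<dots> = p' ` ({z, v} \<inter> f)"
      using u_h2 mem(3) sub p'_ends by auto
    finally show "path_image h2 \<inter> path_image (\<gamma> f) = p' ` ({z, v} \<inter> f)" .
  qed
  have inj': "inj_on p' (verts subdivided)"
    using inj m_verts z unfolding subdivided_def p'_def
    by (auto simp: inj_on_def)
  have edge_cases: "e = {u, z} \<or> e = {z, v} \<or> e \<in> edges G - {{u, v}}" if "e \<in> edges subdivided" for e
    using that by (auto simp: subdivided_def)
  have one: "arc (\<gamma>' e) \<and> {pathstart (\<gamma>' e), pathfinish (\<gamma>' e)} = p' ` e \<and>
      path_image (\<gamma>' e) \<inter> p' ` verts subdivided = p' ` e" if e: "e \<in> edges subdivided" for e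
    using edge_cases[OF e]
  proof (elim disjE)
    assume [simp]: "e = {u, z}"
    have "path_image h1 \<inter> p ` verts G = path_image h1 \<inter> {p u, p v}"
      using h1_sub unfolding h_verts[symmetric] by blast
    then have "path_image h1 \<inter> insert m (p ` verts G) = {p u, m}"
      using v_h1 mem(1,2) by auto
    then show ?thesis by (simp add: \<gamma>'_new h1_arc h_ends' p'_ends p'_verts)
  next
    assume [simp]: "e = {z, v}"
    have "path_image h2 \<inter> p ` verts G = path_image h2 \<inter> {p u, p v}"
      using h2_sub unfolding h_verts[symmetric] by blast
    then have "path_image h2 \<inter> insert m (p ` verts G) = {m, p v}"
      using u_h2 mem(3,4) by auto
    then show ?thesis by (simp add: \<gamma>'_new h2_arc h_ends' p'_ends p'_verts)
  next
    assume e: "e \<in> edges G - {{u, v}}"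
    then have eG: "e \<in> edges G" by simp
    have "path_image (\<gamma> e) \<inter> insert m (p ` verts G) = p ` e"
      using verts_int[OF eG] m_f[OF e] by blast
    then show ?thesis
      using arc[OF eG] ends_eq[OF eG]
      by (simp only: \<gamma>'_f[OF eG] p'_f[OF edge_subset[OF eG]] p'_verts)
  qed
  have two: "path_image (\<gamma>' e) \<inter> path_image (\<gamma>' f) = p' ` (e \<inter> f)"
    if "e \<in> edges subdivided" "f \<in> edges subdivided" "e \<noteq> f" for e f
  proof -
    have uz: "{u, z} \<inter> {z, v} = {z}" "{z, v} \<inter> {u, z} = {z}" using u_neq_v ends by auto
    have old: ?thesis if ef: "e \<in> edges G - {{u, v}}" "f \<in> edges G - {{u, v}}"
    proof -
      have eG: "e \<in> edges G" "f \<in> edges G" using ef by auto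
      then have "e \<inter> f \<subseteq> verts G" using edge_subset by blast
      then show ?thesis
        using edges_int[OF eG \<open>e \<noteq> f\<close>] by (simp only: \<gamma>'_f eG p'_f)
    qed
    have mixed: "path_image (\<gamma>' e) \<inter> path_image (\<gamma>' f) = p' ` (e \<inter> f)"
      if "f \<in> edges G - {{u, v}}" "e = {u, z} \<or> e = {z, v}" for e f
      using that(2) new_f[OF that(1)] \<gamma>'_f[of f] that(1) by (elim disjE) (simp_all add: \<gamma>'_new)
    have new: "path_image (\<gamma>' {u, z}) \<inter> path_image (\<gamma>' {z, v}) = p' ` ({u, z} \<inter> {z, v})"
      by (simp only: \<gamma>'_new h12 uz p'_ends image_insert image_empty)
    show ?thesis
      using edge_cases[OF that(1)] edge_cases[OF that(2)] that(3) old mixed new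
      by (metis Int_commute)
  qed
  have "plane_drawing subdivided p' \<gamma>'"
    unfolding plane_drawing_def using inj' one two by blast
  then show ?thesis unfolding planar_def by blast
qed

end

text \<open>Induction on the number of subdivision vertices still missing; the vertex type
  \<open>nat\<close> always offers a fresh one. Cycle lengths in \<open>H\<close> are weights in
  \<open>G\<close>, and a deleted subdivision vertex is pulled back to an end of the edge that it
  subdivides.\<close>

lemma weighted_subdivision:
  fixes G :: "nat ugraph" and w :: "nat set \<Rightarrow> nat"
  assumes "finite_simple_graph G" "planar G" "\<And>e. e \<in> edges G \<Longrightarrow> 1 \<le> w e"
  shows "\<exists>H :: nat ugraph. finite_simple_graph H \<and> planar H \<and>
    card (verts H) = card (verts G) + (\<Sum>e\<in>edges G. w e - 1) \<and>
    (\<forall>C. is_cycle C \<and> subgraph_of C H \<longrightarrow>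
      (\<exists>D. is_cycle D \<and> subgraph_of D G \<and> card (edges C) = sum w (edges D))) \<and>
    (\<forall>X \<subseteq> verts H. \<exists>Y \<subseteq> verts G. card Y \<le> card X \<and>
      (\<forall>D. is_cycle D \<and> subgraph_of D (delete_verts G Y) \<longrightarrow>
        (\<exists>C. is_cycle C \<and> subgraph_of C (delete_verts H X) \<and> card (edges C) = sum w (edges D))))"
  using assms
proof (induction "\<Sum>e\<in>edges G. w e - 1" arbitrary: G w rule: less_induct)
  case less
  have fin: "finite (edges G)"
    using less.prems(1) by (rule finite_edges)
  show ?case
  proof (cases "\<exists>e\<in>edges G. w e \<noteq> 1")
    case False
    then have "sum w (edges D) = (\<Sum>e\<in>edges D. 1)" if "subgraph_of D G" for D
      using that by (intro sum.cong) (auto simp: subgraph_of_def)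
    then have sum_w: "sum w (edges D) = card (edges D)" if "subgraph_of D G" for D
      using that by simp
    then have "\<exists>D. is_cycle D \<and> subgraph_of D G \<and> card (edges C) = sum w (edges D)"
      if "is_cycle C" "subgraph_of C G" for C
      using that by metis
    moreover have "\<exists>Y \<subseteq> verts G. card Y \<le> card X \<and>
        (\<forall>D. is_cycle D \<and> subgraph_of D (delete_verts G Y) \<longrightarrow>
          (\<exists>C. is_cycle C \<and> subgraph_of C (delete_verts G X) \<and> card (edges C) = sum w (edges D)))"
      if "X \<subseteq> verts G" for X
    proof (intro exI[of _ X] conjI allI impI that order_refl)
      fix D assume D: "is_cycle D \<and> subgraph_of D (delete_verts G X)"
      then have "card (edges D) = sum w (edges D)"
        using sum_w[of D] cycle_subgraph_delete_verts[of D G X] by simp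
      then show "\<exists>C. is_cycle C \<and> subgraph_of C (delete_verts G X) \<and> card (edges C) = sum w (edges D)"
        using D by blast
    qed
    ultimately show ?thesis
      using less.prems False by (intro exI[of _ G]) simp
  next
    case True
    then obtain u v where e: "{u, v} \<in> edges G" "w {u, v} \<noteq> 1"
      using less.prems(1) by (force simp: finite_simple_graph_def card_2_iff)
    have "finite (verts G)"
      using less.prems(1) by (simp add: finite_simple_graph_def)
    then obtain z where z: "z \<notin> verts G"
      using ex_new_if_finite[OF infinite_UNIV_nat] by blast
    interpret edge_subdivision G u v z
      by unfold_locales (use less.prems(1) e z in auto)
    \<comment> \<open>The edge \<open>{u, z}\<close> is finished and \<open>{z, v}\<close> carries
      the remaining weight. The measure drops by one for the one vertex gained, which keeps the
      vertex count in balance.\<close>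
    define w' where "w' = w({u, z} := 1, {z, v} := w {u, v} - 1)"
    have w_uv: "2 \<le> w {u, v}"
      using less.prems(3)[OF uv] e(2) by simp
    have w'_new: "w' {u, z} = 1" "w' {z, v} = w {u, v} - 1"
      using new_edges(3) unfolding w'_def by (simp_all only: fun_upd_same fun_upd_other not_False_eq_True)
    have w'_old: "w' e = w e" if "e \<in> edges G" for e
    proof -
      have "e \<noteq> {u, z}" "e \<noteq> {z, v}" using that new_edges by blast+
      then show ?thesis unfolding w'_def by (simp only: fun_upd_other not_False_eq_True)
    qed
    have w': "w' {u, z} + w' {z, v} = w {u, v}" "\<And>e. e \<in> edges G - {{u, v}} \<Longrightarrow> w' e = w e"
      using w_uv w'_old by (simp_all only: w'_new) auto
    have w'_pos: "1 \<le> w' e" if "e \<in> edges subdivided" for e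
    proof -
      from that consider "e = {u, z}" | "e = {z, v}" | "e \<in> edges G"
        by (auto simp: subdivided_def)
      then show ?thesis
      proof cases
        case 1
        then show ?thesis using w'_new(1) by (metis order_refl)
      next
        case 2
        then have "w' e = w {u, v} - 1" using w'_new(2) by metis
        then show ?thesis using w_uv by linarith
      next
        case 3
        then show ?thesis using less.prems(3)[of e] w'_old[of e] by simp
      qed
    qed
    let ?R = "edges G - {{u, v}}"
    have "edges subdivided = insert {u, z} (insert {z, v} ?R)"
      by (simp add: subdivided_def)
    moreover have "finite ?R" "{z, v} \<notin> ?R" "{u, z} \<notin> insert {z, v} ?R"
      using new_edges fin by blast+
    ultimately have "(\<Sum>e\<in>edges subdivided. w' e - 1) =
        (w' {u, z} - 1) + ((w' {z, v} - 1) + (\<Sum>e\<in>?R. w' e - 1))"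
      by (simp only: sum.insert finite_insert not_False_eq_True)
    then have "(\<Sum>e\<in>edges subdivided. w' e - 1) = (w {u, v} - 2) + (\<Sum>e\<in>?R. w' e - 1)"
      unfolding w'_new by (simp add: numeral_2_eq_2)
    also have "(\<Sum>e\<in>edges G - {{u, v}}. w' e - 1) = (\<Sum>e\<in>edges G - {{u, v}}. w e - 1)"
      using w'(2) by (intro sum.cong) auto
    finally have sum_w': "Suc (\<Sum>e\<in>edges subdivided. w' e - 1) = (\<Sum>e\<in>edges G. w e - 1)"
      using sum.remove[OF fin uv, of "\<lambda>e. w e - 1"] w_uv by simp
    obtain H :: "nat ugraph" where H: "finite_simple_graph H" "planar H"
      "card (verts H) = card (verts subdivided) + (\<Sum>e\<in>edges subdivided. w' e - 1)"
      "\<And>C. is_cycle C \<Longrightarrow> subgraph_of C H \<Longrightarrow>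
        \<exists>D. is_cycle D \<and> subgraph_of D subdivided \<and> card (edges C) = sum w' (edges D)"
      and H_del: "\<And>X. X \<subseteq> verts H \<Longrightarrow> \<exists>Y \<subseteq> verts subdivided. card Y \<le> card X \<and>
        (\<forall>D. is_cycle D \<and> subgraph_of D (delete_verts subdivided Y) \<longrightarrow>
          (\<exists>C. is_cycle C \<and> subgraph_of C (delete_verts H X) \<and> card (edges C) = sum w' (edges D)))"
      using less.hyps[of w' subdivided] sum_w' simple_subdivided planar_subdivided[OF less.prems(2)] w'_pos
      by auto
    have "finite (verts G)" using less.prems(1) by (simp add: finite_simple_graph_def)
    then have "card (verts H) = card (verts G) + (\<Sum>e\<in>edges G. w e - 1)"
      using H(3) sum_w' z by (simp add: subdivided_def)
    moreover have "\<exists>D. is_cycle D \<and> subgraph_of D G \<and> card (edges C) = sum w (edges D)"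
      if "is_cycle C" "subgraph_of C H" for C
      using H(4)[OF that] contract_cycle[where w = w and w' = w', OF w'] by metis
    moreover have "\<exists>Y \<subseteq> verts G. card Y \<le> card X \<and>
        (\<forall>D. is_cycle D \<and> subgraph_of D (delete_verts G Y) \<longrightarrow>
          (\<exists>C. is_cycle C \<and> subgraph_of C (delete_verts H X) \<and> card (edges C) = sum w (edges D)))"
      if X: "X \<subseteq> verts H" for X
    proof -
      obtain Y where Y: "Y \<subseteq> verts subdivided" "card Y \<le> card X"
        "\<And>D. is_cycle D \<Longrightarrow> subgraph_of D (delete_verts subdivided Y) \<Longrightarrow>
          \<exists>C. is_cycle C \<and> subgraph_of C (delete_verts H X) \<and> card (edges C) = sum w' (edges D)"
        using H_del[OF X] by auto
      \<comment> \<open>Trading \<open>z\<close> for \<open>u\<close> does not enlarge the set, and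
        every cycle whose expansion runs through \<open>z\<close> contains \<open>u\<close>.\<close>
      define Z where "Z = (if z \<in> Y then insert u (Y - {z}) else Y)"
      have "finite Y" using Y(1) simple_subdivided by (auto simp: finite_simple_graph_def intro: finite_subset)
      then have "card Z \<le> card Y"
        using card_Suc_Diff1[of Y z] by (auto simp: Z_def card_insert_if simp del: card_Diff_insert)
      moreover have "Z \<subseteq> verts G"
        using Y(1) ends by (auto simp: Z_def subdivided_def)
      moreover have "\<exists>C. is_cycle C \<and> subgraph_of C (delete_verts H X) \<and> card (edges C) = sum w (edges D)"
        if D: "is_cycle D" "subgraph_of D (delete_verts G Z)" for D
      proof -
        have D': "subgraph_of D G" "verts D \<inter> Z = {}"
          using D cycle_subgraph_delete_verts by auto
        obtain E where E: "is_cycle E" "subgraph_of E subdivided" "sum w' (edges E) = sum w (edges D)"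
          "verts E \<subseteq> insert z (verts D)" "z \<in> verts E \<longrightarrow> u \<in> verts D"
          using expand_cycle[where w = w and w' = w', OF w' D(1) D'(1)] by blast
        have "verts E \<inter> Y = {}"
          using E(4,5) D'(2) unfolding Z_def by (auto split: if_splits)
        then show ?thesis
          using Y(3)[of E] E cycle_subgraph_delete_verts[OF E(1)] by auto
      qed
      ultimately show ?thesis using Y(2) by (meson le_trans)
    qed
    ultimately show ?thesis
      using H(1,2) by (intro exI[of _ H]) simp
  qed
qed

section \<open>The grid\<close>

text \<open>The first coordinate is the column, the second the row. Coding points as numbers puts
  the grid on the vertex type of \<open>weighted_subdivision\<close>.\<close>

definition pt :: "nat \<Rightarrow> nat \<Rightarrow> nat" where
  "pt i j = prod_encode (i, j)"

lemma pt_eq_iff [simp]: "pt i j = pt i' j' \<longleftrightarrow> i = i' \<and> j = j'"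
  by (simp add: pt_def)

definition grid :: "nat \<Rightarrow> nat ugraph" where
  "grid n = \<lparr>verts = {pt i j | i j. i < n \<and> j < n},
    edges = {{pt i j, pt (Suc i) j} | i j. Suc i < n \<and> j < n} \<union>
            {{pt i j, pt i (Suc j)} | i j. i < n \<and> Suc j < n}\<rparr>"

lemma grid_verts_eq: "verts (grid n) = (\<lambda>(i, j). pt i j) ` ({..<n} \<times> {..<n})"
  by (auto simp: grid_def)

lemma finite_simple_grid: "finite_simple_graph (grid n)"
  unfolding finite_simple_graph_def by (simp add: grid_verts_eq) (auto simp: grid_def)

lemma card_grid_verts: "card (verts (grid n)) \<le> n * n"
  using card_image_le[of "{..<n} \<times> {..<n}" "\<lambda>(i, j). pt i j"] by (simp add: grid_verts_eq)

lemma card_grid_edges: "card (edges (grid n)) \<le> 2 * n * n"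
proof -
  let ?I = "{..<n} \<times> {..<n}"
  let ?h = "\<lambda>(i, j). {pt i j, pt (Suc i) j}" and ?v = "\<lambda>(i, j). {pt i j, pt i (Suc j)}"
  have "edges (grid n) \<subseteq> ?h ` ?I \<union> ?v ` ?I"
    by (force simp: grid_def)
  then have "card (edges (grid n)) \<le> card (?h ` ?I \<union> ?v ` ?I)"
    by (intro card_mono) auto
  also have "\<dots> \<le> card (?h ` ?I) + card (?v ` ?I)"
    by (rule card_Un_le)
  also have "\<dots> \<le> 2 * n * n"
    using card_image_le[of ?I ?h] card_image_le[of ?I ?v] by simp
  finally show ?thesis .
qed

section \<open>Straight-line drawing of the grid\<close>

lemma closed_segment_horizontal:
  "closed_segment (a, c) (a + 1, c) = {a :: real..a + 1} \<times> {c :: real}"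
proof -
  have "(x, y) \<in> closed_segment (a, c) (a + 1, c) \<longleftrightarrow> a \<le> x \<and> x \<le> a + 1 \<and> y = c" for x y
  proof
    assume "(x, y) \<in> closed_segment (a, c) (a + 1, c)"
    then show "a \<le> x \<and> x \<le> a + 1 \<and> y = c"
      by (auto simp: in_segment algebra_simps)
  next
    assume "a \<le> x \<and> x \<le> a + 1 \<and> y = c"
    then show "(x, y) \<in> closed_segment (a, c) (a + 1, c)"
      unfolding in_segment by (intro exI[of _ "x - a"]) (auto simp: algebra_simps)
  qed
  then show ?thesis by auto
qed

lemma closed_segment_vertical:
  "closed_segment (c, a) (c, a + 1) = {c :: real} \<times> {a :: real..a + 1}"
proof -
  have "(x, y) \<in> closed_segment (c, a) (c, a + 1) \<longleftrightarrow> a \<le> y \<and> y \<le> a + 1 \<and> x = c" for x y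
  proof
    assume "(x, y) \<in> closed_segment (c, a) (c, a + 1)"
    then show "a \<le> y \<and> y \<le> a + 1 \<and> x = c"
      by (auto simp: in_segment algebra_simps)
  next
    assume "a \<le> y \<and> y \<le> a + 1 \<and> x = c"
    then show "(x, y) \<in> closed_segment (c, a) (c, a + 1)"
      unfolding in_segment by (intro exI[of _ "y - a"]) (auto simp: algebra_simps)
  qed
  then show ?thesis by auto
qed

text \<open>Points are drawn at their integer coordinates and edges as unit segments. A point inside
  such a segment lies strictly between consecutive integers in exactly one coordinate, which
  determines the segment.\<close>

lemma planar_grid: "planar (grid n)"
proof -
  define p where "p k = (real (fst (prod_decode k)), real (snd (prod_decode k)))" for k
  \<comment> \<open>An edge is an unordered pair; the choice picks some order for the line path, and
    either order gives the same segment.\<close>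
  define ends where "ends e = (SOME (a, b). e = {a, b})" for e :: "nat set"
  define \<gamma> where "\<gamma> e = linepath (p (fst (ends e))) (p (snd (ends e)))" for e
  have p_pt [simp]: "p (pt i j) = (real i, real j)" for i j
    by (simp add: p_def pt_def)
  have inj: "inj p"
    unfolding inj_def p_def by (metis Pair_inject of_nat_eq_iff prod.collapse prod_decode_eq)
  have ends: "ends {a, b} = (a, b) \<or> ends {a, b} = (b, a)" for a b
  proof -
    have "case ends {a, b} of (c, d) \<Rightarrow> {a, b} = {c, d}"
      unfolding ends_def by (rule someI[of _ "(a, b)"]) simp
    then show ?thesis by (auto simp: doubleton_eq_iff)
  qed
  have \<gamma>: "arc (\<gamma> {a, b})" "{pathstart (\<gamma> {a, b}), pathfinish (\<gamma> {a, b})} = p ` {a, b}"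
    "path_image (\<gamma> {a, b}) = closed_segment (p a) (p b)" if "a \<noteq> b" for a b
  proof -
    have "p a \<noteq> p b" using that inj by (auto dest: injD)
    then show "arc (\<gamma> {a, b})" "{pathstart (\<gamma> {a, b}), pathfinish (\<gamma> {a, b})} = p ` {a, b}"
      "path_image (\<gamma> {a, b}) = closed_segment (p a) (p b)"
      using ends[of a b] by (auto simp: \<gamma>_def closed_segment_commute intro: arc_linepath)
  qed
  have cases: "(\<exists>i j. e = {pt i j, pt (Suc i) j} \<and> path_image (\<gamma> e) = {real i..real i + 1} \<times> {real j}) \<or>
      (\<exists>i j. e = {pt i j, pt i (Suc j)} \<and> path_image (\<gamma> e) = {real i} \<times> {real j..real j + 1})"
    if "e \<in> edges (grid n)" for e
  proof -
    from that consider i j where "e = {pt i j, pt (Suc i) j}" | i j where "e = {pt i j, pt i (Suc j)}"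
      by (auto simp: grid_def)
    then show ?thesis
    proof cases
      case 1
      then show ?thesis
        using \<gamma>(3)[of "pt i j" "pt (Suc i) j"] closed_segment_horizontal[of "real i" "real j"]
        by (auto simp: add.commute)
    next
      case 2
      then show ?thesis
        using \<gamma>(3)[of "pt i j" "pt i (Suc j)"] closed_segment_vertical[of "real i" "real j"]
        by (auto simp: add.commute)
    qed
  qed
  have between: "a = i \<or> a = Suc i" if "real i \<le> real a" "real a \<le> real i + 1" for a i
    using that by linarith
  have ends_sub: "p ` e \<subseteq> path_image (\<gamma> e)" if "e \<in> edges (grid n)" for e
    using cases[OF that]
  proof (elim disjE exE conjE)
    fix i j assume eq: "e = {pt i j, pt (Suc i) j}" "path_image (\<gamma> e) = {real i..real i + 1} \<times> {real j}"
    show ?thesis unfolding eq(2) by (simp add: eq(1))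
  next
    fix i j assume eq: "e = {pt i j, pt i (Suc j)}" "path_image (\<gamma> e) = {real i} \<times> {real j..real j + 1}"
    show ?thesis unfolding eq(2) by (simp add: eq(1))
  qed
  have pt_image: "pt a b \<in> e" if e: "e \<in> edges (grid n)" and ab: "(real a, real b) \<in> path_image (\<gamma> e)" for e a b
    using cases[OF e]
  proof (elim disjE exE conjE)
    fix i j assume eq: "e = {pt i j, pt (Suc i) j}" "path_image (\<gamma> e) = {real i..real i + 1} \<times> {real j}"
    have "real i \<le> real a" "real a \<le> real i + 1" "real b = real j"
      using ab unfolding eq(2) by auto
    then show ?thesis using between[of i a] by (auto simp: eq(1))
  next
    fix i j assume eq: "e = {pt i j, pt i (Suc j)}" "path_image (\<gamma> e) = {real i} \<times> {real j..real j + 1}"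
    have "real j \<le> real b" "real b \<le> real j + 1" "real a = real i"
      using ab unfolding eq(2) by auto
    then show ?thesis using between[of j b] by (auto simp: eq(1))
  qed
  have verts_sub: "path_image (\<gamma> e) \<inter> p ` verts (grid n) \<subseteq> p ` e" if "e \<in> edges (grid n)" for e
  proof
    fix q assume q: "q \<in> path_image (\<gamma> e) \<inter> p ` verts (grid n)"
    then obtain a b where ab: "q = p (pt a b)" by (auto simp: grid_def)
    then have "pt a b \<in> e" using q pt_image[OF that, of a b] by simp
    then show "q \<in> p ` e" unfolding ab by (rule imageI)
  qed
  \<comment> \<open>A common point that is not an end of \<open>e\<close> has one coordinate
    strictly between consecutive integers. For parallel edges this forces \<open>e = f\<close>
    (\<open>same\<close>); for perpendicular ones that coordinate is constant and integral on
    \<open>f\<close> (\<open>apart\<close>).\<close>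
  have sub: "path_image (\<gamma> e) \<inter> path_image (\<gamma> f) \<subseteq> p ` e"
    if e: "e \<in> edges (grid n)" and f: "f \<in> edges (grid n)" and "e \<noteq> f" for e f
  proof (rule ccontr)
    assume "\<not> ?thesis"
    then obtain x y where xy: "(x, y) \<in> path_image (\<gamma> e)" "(x, y) \<in> path_image (\<gamma> f)" "(x, y) \<notin> p ` e"
      by auto
    have same: "i' = i" if "real i \<le> z" "z \<le> real i + 1" "z \<noteq> real i" "z \<noteq> real i + 1"
      "real i' \<le> z" "z \<le> real i' + 1" for i i' z
    proof -
      have "real i < real (Suc i')" "real i' < real (Suc i)" using that by auto
      then show ?thesis unfolding of_nat_less_iff by simp
    qed
    have apart: False if "real i \<le> real a" "real a \<le> real i + 1" "real a \<noteq> real i" "real a \<noteq> real i + 1"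
      for i a
    proof -
      have "real i < real a" "real a < real (Suc i)" using that by auto
      then show ?thesis unfolding of_nat_less_iff by simp
    qed
    show False
      using cases[OF e] cases[OF f]
    proof (elim disjE exE conjE)
      fix i j i' j'
      assume "e = {pt i j, pt (Suc i) j}" "path_image (\<gamma> e) = {real i..real i + 1} \<times> {real j}"
        "f = {pt i' j', pt (Suc i') j'}" "path_image (\<gamma> f) = {real i'..real i' + 1} \<times> {real j'}"
      then show False using xy \<open>e \<noteq> f\<close> same[of i x i'] by (auto simp: add.commute)
    next
      fix i j i' j'
      assume "e = {pt i j, pt i (Suc j)}" "path_image (\<gamma> e) = {real i} \<times> {real j..real j + 1}"
        "f = {pt i' j', pt i' (Suc j')}" "path_image (\<gamma> f) = {real i'} \<times> {real j'..real j' + 1}"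
      then show False using xy \<open>e \<noteq> f\<close> same[of j y j'] by (auto simp: add.commute)
    next
      fix i j i' j'
      assume "e = {pt i j, pt (Suc i) j}" "path_image (\<gamma> e) = {real i..real i + 1} \<times> {real j}"
        "f = {pt i' j', pt i' (Suc j')}" "path_image (\<gamma> f) = {real i'} \<times> {real j'..real j' + 1}"
      then show False using xy apart[of i i'] by (auto simp: add.commute)
    next
      fix i j i' j'
      assume "e = {pt i j, pt i (Suc j)}" "path_image (\<gamma> e) = {real i} \<times> {real j..real j + 1}"
        "f = {pt i' j', pt (Suc i') j'}" "path_image (\<gamma> f) = {real i'..real i' + 1} \<times> {real j'}"
      then show False using xy apart[of j j'] by (auto simp: add.commute)
    qed
  qed
  have verts_eq: "path_image (\<gamma> e) \<inter> p ` verts (grid n) = p ` e" if "e \<in> edges (grid n)" for e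
  proof -
    have "p ` e \<subseteq> p ` verts (grid n)"
      using finite_simple_grid[of n] that by (intro image_mono) (simp add: finite_simple_graph_def)
    then show ?thesis using verts_sub[OF that] ends_sub[OF that] by blast
  qed
  \<comment> \<open>\<open>sub\<close> is one-sided; used in both directions it puts common points
    into \<open>p\<close> e\<open>and\<close>p \<open>f\<close>, and \<open>p\<close> is
    injective.\<close>
  have edges_eq: "path_image (\<gamma> e) \<inter> path_image (\<gamma> f) = p ` (e \<inter> f)"
    if "e \<in> edges (grid n)" "f \<in> edges (grid n)" "e \<noteq> f" for e f
    using sub[OF that] sub[OF that(2,1)] ends_sub that unfolding image_Int[OF inj] by blast
  have arcs: "arc (\<gamma> e) \<and> {pathstart (\<gamma> e), pathfinish (\<gamma> e)} = p ` e" if "e \<in> edges (grid n)" for e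
  proof -
    have "card e = 2"
      using that finite_simple_grid[of n] by (simp add: finite_simple_graph_def)
    then obtain a b where e: "e = {a, b}" "a \<noteq> b"
      by (auto simp: card_2_iff)
    show ?thesis unfolding e(1) using \<gamma>(1,2)[OF e(2)] by (rule conjI)
  qed
  have "plane_drawing (grid n) p \<gamma>"
    unfolding plane_drawing_def
    by (intro conjI ballI impI inj_on_subset[OF inj subset_UNIV] arcs[THEN conjunct1]
        arcs[THEN conjunct2] verts_eq edges_eq)
  then show ?thesis unfolding planar_def by blast
qed

section \<open>Paths along rows and columns of the grid\<close>

lemma path_edges_append_nonempty:
  assumes "xs \<noteq> []" "ys \<noteq> []"
  shows "path_edges (xs @ ys) = insert {last xs, hd ys} (path_edges xs \<union> path_edges ys)"
proof -
  obtain xs' a b ys' where "xs = xs' @ [a]" "ys = b # ys'"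
    using assms by (metis neq_Nil_conv rev_exhaust)
  then show ?thesis
    using path_edges_append[of xs' a "b # ys'"] by auto
qed

lemma path_edges_map_upt:
  "path_edges (map f [a..<b]) = {{f i, f (Suc i)} | i. a \<le> i \<and> Suc i < b}"
proof -
  have "{f i, f (Suc i)} \<in> path_edges (map f [a..<b])" if "a \<le> i" "Suc i < b" for i
    using that unfolding path_edges_conv_nth by (intro CollectI exI[of _ "i - a"]) auto
  then show ?thesis
    unfolding path_edges_conv_nth by fastforce
qed

lemma grid_step:
  "Suc i < n \<Longrightarrow> j < n \<Longrightarrow> {pt i j, pt (Suc i) j} \<in> edges (grid n)"
  "Suc i < n \<Longrightarrow> j < n \<Longrightarrow> {pt (Suc i) j, pt i j} \<in> edges (grid n)"
  "i < n \<Longrightarrow> Suc j < n \<Longrightarrow> {pt i j, pt i (Suc j)} \<in> edges (grid n)"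
  "i < n \<Longrightarrow> Suc j < n \<Longrightarrow> {pt i (Suc j), pt i j} \<in> edges (grid n)"
  by (auto simp: grid_def)

lemma grid_row_edges:
  assumes "b \<le> n" "j < n"
  shows "path_edges (map (\<lambda>i. pt i j) [a..<b]) \<subseteq> edges (grid n)"
  using assms unfolding path_edges_map_upt by (auto intro!: grid_step)

lemma grid_col_edges:
  assumes "b \<le> n" "i < n"
  shows "path_edges (map (pt i) [a..<b]) \<subseteq> edges (grid n)"
  using assms unfolding path_edges_map_upt by (auto intro!: grid_step)

section \<open>Comb cycles\<close>

lemma path_edges_append_subset:
  assumes "path_edges xs \<subseteq> E" "path_edges ys \<subseteq> E" "xs \<noteq> []" "ys \<noteq> []" "{last xs, hd ys} \<in> E"
  shows "path_edges (xs @ ys) \<subseteq> E"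
  using assms by (simp add: path_edges_append_nonempty)

lemma last_map_upt: "a < b \<Longrightarrow> last (map f [a..<b]) = f (b - 1)"
  by (simp add: last_map)

lemma hd_map_upt: "a < b \<Longrightarrow> hd (map f [a..<b]) = f a"
  by (simp add: hd_map)

text \<open>Here \<open>l\<close> and \<open>r\<close> are columns, \<open>lo\<close> and
  \<open>hi\<close> are rows. The path climbs column \<open>r\<close> and uses the rows of
  \<open>A\<close> in pairs: on the lower one it crosses to column \<open>l\<close>, climbs there to
  the upper one and crosses back. Vertical steps add up to \<open>hi - lo\<close> and each row of
  \<open>A\<close> costs \<open>r - l\<close>, so the length depends only on the size of
  \<open>A\<close>. The last two conditions keep rows \<open>lo\<close> and \<open>hi\<close> free
  for closing the path to a cycle.\<close>

lemma snake_path: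
  assumes "finite A" "card A = 2 * k" "A \<subseteq> {lo<..<hi}" "lo < hi" "hi < n" "l < r" "r < n"
  shows "\<exists>xs. distinct xs \<and> xs \<noteq> [] \<and> hd xs = pt r lo \<and> last xs = pt r hi \<and>
    path_edges xs \<subseteq> edges (grid n) \<and> length xs = (hi - lo) + 1 + 2 * k * (r - l) \<and>
    set xs \<subseteq> {pt i j | i j. l \<le> i \<and> i \<le> r \<and> lo \<le> j \<and> j \<le> hi \<and> (i = l \<or> i = r \<or> j \<in> A) \<and>
      (j = lo \<longrightarrow> i = r) \<and> (j = hi \<longrightarrow> i = r)}"
  using assms
proof (induction k arbitrary: lo A)
  case 0
  let ?xs = "map (pt r) [lo..<Suc hi]"
  have "path_edges ?xs \<subseteq> edges (grid n)"
    using 0 by (intro grid_col_edges) auto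
  moreover have "hd ?xs = pt r lo" "last ?xs = pt r hi"
    using 0 hd_map_upt[of lo "Suc hi" "pt r"] last_map_upt[of lo "Suc hi" "pt r"] by auto
  ultimately show ?case
    using 0 by (intro exI[of _ ?xs]) (auto simp: distinct_map inj_on_def simp del: upt_Suc)
next
  case (Suc k)
  \<comment> \<open>The two lowest rows \<open>a < b\<close> of \<open>A\<close> form the first
    detour; the induction hypothesis continues from \<open>pt r b\<close>.\<close>
  define a where "a = Min A"
  have "A \<noteq> {}" using Suc.prems(2) by auto
  then have a: "a \<in> A" and a_min: "\<And>x. x \<in> A \<Longrightarrow> a \<le> x"
    using Suc.prems(1) by (auto simp: a_def)
  define A1 where "A1 = A - {a}"
  have A1: "finite A1" "card A1 = 2 * k + 1"
    using Suc.prems(1,2) a by (auto simp: A1_def)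
  define b where "b = Min A1"
  have "A1 \<noteq> {}" using A1(2) by auto
  then have b: "b \<in> A1" and b_min: "\<And>x. x \<in> A1 \<Longrightarrow> b \<le> x"
    using A1(1) by (auto simp: b_def)
  define A2 where "A2 = A1 - {b}"
  have A2: "finite A2" "card A2 = 2 * k"
    using A1 b by (auto simp: A2_def)
  have A_eq: "A = insert a (insert b A2)"
    using a b by (auto simp: A1_def A2_def)
  have ord: "lo < a" "a < b" "b < hi"
    using Suc.prems(3) a b a_min[of b] by (auto simp: A1_def)
  have A2_gt: "A2 \<subseteq> {b<..<hi}"
    using Suc.prems(3) b_min by (force simp: A1_def A2_def)
  obtain ys where ys: "distinct ys" "ys \<noteq> []" "hd ys = pt r b" "last ys = pt r hi"
    "path_edges ys \<subseteq> edges (grid n)" "length ys = (hi - b) + 1 + 2 * k * (r - l)"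
    "set ys \<subseteq> {pt i j | i j. l \<le> i \<and> i \<le> r \<and> b \<le> j \<and> j \<le> hi \<and> (i = l \<or> i = r \<or> j \<in> A2) \<and>
      (j = b \<longrightarrow> i = r) \<and> (j = hi \<longrightarrow> i = r)}"
    using Suc.IH[OF A2 A2_gt ord(3) Suc.prems(5-7)] by blast
  \<comment> \<open>Up column \<open>r\<close>, across row \<open>a\<close> to column
    \<open>l\<close>, up column \<open>l\<close>, back across row \<open>b\<close>; each piece stops
    one point before the next begins.\<close>
  define s1 where "s1 = map (pt r) [lo..<a]"
  define s2 where "s2 = rev (map (\<lambda>i. pt i a) [Suc l..<Suc r])"
  define s3 where "s3 = map (pt l) [a..<b]"
  define s4 where "s4 = map (\<lambda>i. pt i b) [l..<r]"
  define xs where "xs = s1 @ s2 @ s3 @ s4 @ ys"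
  have lr: "l < r" "r < n" "hi < n" using Suc.prems by auto
  have ne: "s1 \<noteq> []" "s2 \<noteq> []" "s3 \<noteq> []" "s4 \<noteq> []"
    using ord lr by (auto simp: s1_def s2_def s3_def s4_def simp del: upt_Suc)
  have hds: "hd s1 = pt r lo" "hd s2 = pt r a" "hd s3 = pt l a" "hd s4 = pt l b"
    using ord lr by (simp_all add: s1_def s2_def s3_def s4_def hd_map_upt last_map_upt hd_rev
        del: upt_Suc)
  have lasts: "last s1 = pt r (a - 1)" "last s2 = pt (Suc l) a" "last s3 = pt l (b - 1)" "last s4 = pt (r - 1) b"
    using ord lr by (simp_all add: s1_def s2_def s3_def s4_def hd_map_upt last_map_upt last_rev
        del: upt_Suc)
  have sets: "set s1 = pt r ` {lo..<a}" "set s2 = (\<lambda>i. pt i a) ` {l<..r}"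
    "set s3 = pt l ` {a..<b}" "set s4 = (\<lambda>i. pt i b) ` {l..<r}"
    by (auto simp: s1_def s2_def s3_def s4_def simp del: upt_Suc)
  have path: "path_edges s1 \<subseteq> edges (grid n)" "path_edges s2 \<subseteq> edges (grid n)"
    "path_edges s3 \<subseteq> edges (grid n)" "path_edges s4 \<subseteq> edges (grid n)"
    unfolding s1_def s2_def s3_def s4_def path_edges_rev
    using ord lr by (simp_all add: grid_col_edges grid_row_edges del: upt_Suc)
  have joins: "{last s1, hd s2} \<in> edges (grid n)" "{last s2, hd s3} \<in> edges (grid n)"
    "{last s3, hd s4} \<in> edges (grid n)" "{last s4, hd ys} \<in> edges (grid n)"
    using grid_step(3)[of r n "a - 1"] grid_step(2)[of l n a] grid_step(3)[of l n "b - 1"]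
      grid_step(1)[of "r - 1" n b] ord lr
    by (simp_all add: hds lasts ys(3))
  have xs_path: "path_edges xs \<subseteq> edges (grid n)"
    unfolding xs_def using path joins ne ys(2,5) by (intro path_edges_append_subset) auto
  have xs_ends: "xs \<noteq> []" "hd xs = pt r lo" "last xs = pt r hi"
    using ne hds ys by (auto simp: xs_def)
  have xs_dist: "distinct xs"
  proof -
    have dist: "distinct s1" "distinct s2" "distinct s3" "distinct s4"
      by (auto simp: s1_def s2_def s3_def s4_def distinct_map inj_on_def simp del: upt_Suc)
    \<comment> \<open>\<open>ys\<close> lives in rows from \<open>b\<close> upwards and meets row
      \<open>b\<close> only in column \<open>r\<close>, where \<open>s4\<close> does not
      arrive.\<close>
    have "set ys \<inter> (set s1 \<union> set s2 \<union> set s3 \<union> set s4) = {}"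
      using ys(7) ord lr unfolding sets by fastforce
    moreover have "set s1 \<inter> set s2 = {}" "set s1 \<inter> set s3 = {}" "set s1 \<inter> set s4 = {}"
      "set s2 \<inter> set s3 = {}" "set s2 \<inter> set s4 = {}" "set s3 \<inter> set s4 = {}"
      using ord lr unfolding sets by auto
    ultimately show ?thesis
      using dist ys(1) unfolding xs_def distinct_append set_append by blast
  qed
  have xs_len: "length xs = (hi - lo) + 1 + 2 * Suc k * (r - l)"
  proof -
    define d where "d = r - l"
    have "length xs = (a - lo) + d + (b - a) + d + ((hi - b) + 1 + 2 * k * d)"
      using ys(6) by (simp add: xs_def s1_def s2_def s3_def s4_def d_def del: upt_Suc)
    also have "\<dots> = (hi - lo) + 1 + 2 * Suc k * d"
      using ord by simp
    finally show ?thesis by (simp only: d_def)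
  qed
  have xs_set: "set xs \<subseteq> {pt i j | i j. l \<le> i \<and> i \<le> r \<and> lo \<le> j \<and> j \<le> hi \<and> (i = l \<or> i = r \<or> j \<in> A) \<and>
      (j = lo \<longrightarrow> i = r) \<and> (j = hi \<longrightarrow> i = r)}" (is "_ \<subseteq> ?S")
  proof -
    have "set s1 \<subseteq> ?S" "set s2 \<subseteq> ?S" "set s3 \<subseteq> ?S" "set s4 \<subseteq> ?S"
      using ord lr unfolding sets A_eq by auto
    moreover have "set ys \<subseteq> ?S"
    proof
      fix q assume "q \<in> set ys"
      then obtain i j where ij: "q = pt i j" "l \<le> i" "i \<le> r" "b \<le> j" "j \<le> hi"
        "i = l \<or> i = r \<or> j \<in> A2" "j = hi \<longrightarrow> i = r"
        using ys(7) by blast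
      then show "q \<in> ?S" using ord by (simp add: A_eq) blast
    qed
    ultimately show ?thesis by (auto simp: xs_def)
  qed
  show ?case
    by (rule exI[of _ xs]) (intro conjI xs_dist xs_ends xs_path xs_len xs_set)
qed

definition seam :: "nat \<Rightarrow> nat set set" where
  "seam s = {{pt i (s - 1), pt i s} | i. i < s}"

text \<open>The snake between columns \<open>c + s\<close> and \<open>c + 3 * s\<close> forms the
  teeth, and it is closed along the two outer rows and column \<open>c\<close>. That column is the
  only part of the cycle that can use the seam, and it crosses it once because \<open>r < s\<close>
  and \<open>s < r + 3 * s\<close>.\<close>

lemma comb_cycle:
  assumes "r < s" "c < s" "A \<subseteq> {r<..<r + 3 * s}" "card A = 2 * s"
  shows "\<exists>C. is_cycle C \<and> subgraph_of C (grid (4 * s)) \<and> card (edges C) = 4 * s * s + 12 * s \<and>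
    card (edges C \<inter> seam s) = 1 \<and>
    verts C \<subseteq> {pt i j | i j. i \<in> {c, c + s, c + 3 * s} \<or> j \<in> A \<union> {r, r + 3 * s}}"
proof -
  define n where "n = 4 * s"
  define hi where "hi = r + 3 * s"
  define m where "m = c + 3 * s"
  have bounds: "r < hi" "hi < n" "c + s < m" "m < n" "c < m"
    using assms by (auto simp: n_def hi_def m_def)
  have "finite A" using assms(3) finite_subset by blast
  then obtain xs where xs: "distinct xs" "xs \<noteq> []" "hd xs = pt m r" "last xs = pt m hi"
    "path_edges xs \<subseteq> edges (grid n)" "length xs = (hi - r) + 1 + 2 * s * (m - (c + s))"
    "set xs \<subseteq> {pt i j | i j. c + s \<le> i \<and> i \<le> m \<and> r \<le> j \<and> j \<le> hi \<and> (i = c + s \<or> i = m \<or> j \<in> A) \<and>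
      (j = r \<longrightarrow> i = m) \<and> (j = hi \<longrightarrow> i = m)}"
    using snake_path[of A s r hi n "c + s" m] assms(3,4) bounds by (auto simp: hi_def)
  \<comment> \<open>From the top of the snake back along row \<open>hi\<close>, down column
    \<open>c\<close>, and out along row \<open>r\<close> to the start of the snake.\<close>
  define s1 where "s1 = rev (map (\<lambda>i. pt i hi) [Suc c..<m])"
  define s2 where "s2 = rev (map (pt c) [r..<Suc hi])"
  define s3 where "s3 = map (\<lambda>i. pt i r) [Suc c..<m]"
  define vs where "vs = xs @ s1 @ s2 @ s3"
  have lt: "Suc c < m" using bounds assms by auto
  have ne: "s1 \<noteq> []" "s2 \<noteq> []" "s3 \<noteq> []"
    using bounds lt by (auto simp: s1_def s2_def s3_def simp del: upt_Suc)
  have hds: "hd s1 = pt (m - 1) hi" "hd s2 = pt c hi" "hd s3 = pt (Suc c) r"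
    using bounds lt by (simp_all add: s1_def s2_def s3_def hd_map_upt last_map_upt hd_rev del: upt_Suc)
  have lasts: "last s1 = pt (Suc c) hi" "last s2 = pt c r" "last s3 = pt (m - 1) r"
    using bounds lt by (simp_all add: s1_def s2_def s3_def hd_map_upt last_map_upt last_rev del: upt_Suc)
  have sets: "set s1 = (\<lambda>i. pt i hi) ` {c<..<m}" "set s2 = pt c ` {r..hi}" "set s3 = (\<lambda>i. pt i r) ` {c<..<m}"
    by (auto simp: s1_def s2_def s3_def simp del: upt_Suc)
  have path: "path_edges s1 \<subseteq> edges (grid n)" "path_edges s2 \<subseteq> edges (grid n)"
    "path_edges s3 \<subseteq> edges (grid n)"
    unfolding s1_def s2_def s3_def path_edges_rev
    using bounds by (simp_all add: grid_col_edges grid_row_edges del: upt_Suc)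
  have joins: "{last xs, hd s1} \<in> edges (grid n)" "{last s1, hd s2} \<in> edges (grid n)"
    "{last s2, hd s3} \<in> edges (grid n)" "{last s3, hd xs} \<in> edges (grid n)"
    using grid_step(2)[of "m - 1" n hi] grid_step(2)[of c n hi] grid_step(1)[of c n r]
      grid_step(1)[of "m - 1" n r] bounds
    by (simp_all add: hds lasts xs(3,4))
  have vs_path: "path_edges vs \<subseteq> edges (grid n)"
    unfolding vs_def using path joins ne xs(2,5) by (intro path_edges_append_subset) auto
  have hd_vs: "hd vs = hd xs" and last_vs: "last vs = last s3" and vs_ne: "vs \<noteq> []"
    using xs(2) ne by (auto simp: vs_def)
  have cycle_sub: "cycle_edges vs \<subseteq> edges (grid n)"
    unfolding cycle_edges_def using vs_path joins(4) vs_ne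
    by (intro path_edges_append_subset) (auto simp: hd_vs last_vs)
  have dist: "distinct vs"
  proof -
    have "distinct s1" "distinct s2" "distinct s3"
      by (auto simp: s1_def s2_def s3_def distinct_map inj_on_def simp del: upt_Suc)
    moreover have "set xs \<inter> (set s1 \<union> set s2 \<union> set s3) = {}"
      using xs(7) bounds assms(2) unfolding sets by fastforce
    moreover have "set s1 \<inter> set s2 = {}" "set s1 \<inter> set s3 = {}" "set s2 \<inter> set s3 = {}"
      using bounds unfolding sets by auto
    ultimately show ?thesis
      using xs(1) unfolding vs_def distinct_append set_append by blast
  qed
  \<comment> \<open>The four pieces have \<open>4 * s * s + 3 * s + 1\<close>,
    \<open>3 * s - 1\<close>, \<open>3 * s + 1\<close> and \<open>3 * s - 1\<close>
    vertices.\<close>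
  have len: "length vs = 4 * s * s + 12 * s"
  proof -
    have "length vs = (hi - r) + 1 + 2 * s * (m - (c + s)) + (m - Suc c) + (Suc hi - r) + (m - Suc c)"
      by (simp add: vs_def xs(6) s1_def s2_def s3_def del: upt_Suc)
    moreover have "hi - r = 3 * s" "m - (c + s) = 2 * s" "m - Suc c = 3 * s - 1" "Suc hi - r = 3 * s + 1"
      by (auto simp: hi_def m_def)
    ultimately show ?thesis using assms(1) by simp
  qed
  have verts_sub: "set vs \<subseteq> {pt i j | i j. i \<in> {c, c + s, m} \<or> j \<in> A \<union> {r, hi}}"
    using xs(7) by (auto simp: vs_def sets)
  have edge_verts: "e \<subseteq> set vs" if "e \<in> cycle_edges vs" for e
    using that path_edges_subset_set[of e "vs @ [hd vs]"] vs_ne by (auto simp: cycle_edges_def)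
  have "cycle_edges vs \<inter> seam s = {{pt c (s - 1), pt c s}}"
  proof
    show "cycle_edges vs \<inter> seam s \<subseteq> {{pt c (s - 1), pt c s}}"
    proof
      fix e assume e: "e \<in> cycle_edges vs \<inter> seam s"
      then obtain i where i: "e = {pt i (s - 1), pt i s}" "i < s"
        by (auto simp: seam_def)
      \<comment> \<open>The upper end of a seam edge suffices to find its column: the snake stays in
        columns from \<open>s\<close> on, and neither outer row is row \<open>s\<close>.\<close>
      have "pt i s \<in> set vs"
        using e edge_verts[of e] i(1) by simp
      moreover have "pt i s \<notin> set xs"
        using xs(7) i(2) by auto
      ultimately have "i = c"
        using assms(1) by (auto simp: vs_def sets hi_def)
      then show "e \<in> {{pt c (s - 1), pt c s}}" using i(1) by simp
    qed
    have "{pt c (s - 1), pt c (Suc (s - 1))} \<in> path_edges s2"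
      unfolding s2_def path_edges_rev path_edges_map_upt using assms(1)
      by (intro CollectI exI[of _ "s - 1"]) (auto simp: hi_def)
    moreover have "path_edges s2 \<subseteq> cycle_edges vs"
      using xs(2) ne by (auto simp: cycle_edges_def vs_def path_edges_append_nonempty)
    ultimately show "{{pt c (s - 1), pt c s}} \<subseteq> cycle_edges vs \<inter> seam s"
      using assms(1,2) by (auto simp: seam_def)
  qed
  moreover define C where "C = \<lparr>verts = set vs, edges = cycle_edges vs\<rparr>"
  moreover have "3 \<le> length vs"
    using len assms(1) by simp
  moreover have "set vs \<subseteq> verts (grid n)"
  proof -
    have "set xs \<subseteq> verts (grid n)"
    proof
      fix q assume "q \<in> set xs"
      then obtain i j where "q = pt i j" "i \<le> m" "j \<le> hi" using xs(7) by blast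
      then show "q \<in> verts (grid n)" using bounds by (simp add: grid_def)
    qed
    then show ?thesis using bounds by (auto simp: vs_def sets grid_def)
  qed
  moreover have "is_cycle C"
    unfolding is_cycle_iff C_def using dist \<open>3 \<le> length vs\<close> by auto
  ultimately show ?thesis
    using cycle_sub card_cycle_edges[OF dist] len verts_sub
    by (intro exI[of _ C]) (simp add: C_def subgraph_of_def n_def hi_def m_def)
qed

lemma comb_cycle_avoiding:
  assumes "Y \<subseteq> verts (grid (4 * s))" "card Y < s"
  shows "\<exists>C. is_cycle C \<and> subgraph_of C (delete_verts (grid (4 * s)) Y) \<and>
    card (edges C) = 4 * s * s + 12 * s \<and> card (edges C \<inter> seam s) = 1"
proof -
  have finY: "finite Y"
    using assms(1) finite_simple_grid by (auto simp: finite_simple_graph_def intro: finite_subset)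
  define cols where "cols = (fst \<circ> prod_decode) ` Y"
  define rows where "rows = (snd \<circ> prod_decode) ` Y"
  have fin: "finite cols" "finite rows" and card: "card cols < s" "card rows < s"
    using finY assms(2) card_image_le[OF finY] by (auto simp: cols_def rows_def intro: le_less_trans)
  \<comment> \<open>Fewer than \<open>s\<close> numbers miss a residue class modulo
    \<open>s\<close>, so one choice of \<open>c\<close> clears \<open>c\<close>,
    \<open>c + s\<close> and \<open>c + 3 * s\<close> at once. This is why the columns and the outer
    rows have distances divisible by \<open>s\<close>.\<close>
  have free: "\<exists>c<s. \<forall>q. c + q * s \<notin> Z" if "finite Z" "card Z < s" for Z :: "nat set"
  proof -
    have "card ((\<lambda>i. i mod s) ` Z) < card {..<s}"
      using card_image_le[OF that(1), of "\<lambda>i. i mod s"] that(2) by simp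
    then have "\<not> {..<s} \<subseteq> (\<lambda>i. i mod s) ` Z"
      using card_mono[of "(\<lambda>i. i mod s) ` Z" "{..<s}"] that(1) by auto
    then obtain c where c: "c < s" "c \<notin> (\<lambda>i. i mod s) ` Z" by auto
    have "c + q * s \<notin> Z" for q
    proof
      assume "c + q * s \<in> Z"
      then have "(c + q * s) mod s \<in> (\<lambda>i. i mod s) ` Z" by blast
      then show False using c by simp
    qed
    then show ?thesis using c(1) by blast
  qed
  obtain c where c: "c < s" "\<And>q. c + q * s \<notin> cols" using free[OF fin(1) card(1)] by blast
  obtain r where r: "r < s" "\<And>q. r + q * s \<notin> rows" using free[OF fin(2) card(2)] by blast
  \<comment> \<open>Of the \<open>3 * s - 1\<close> rows strictly between the outer ones at most
    \<open>s - 1\<close> are damaged, which leaves the \<open>2 * s\<close> rows needed for the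
    teeth.\<close>
  have "3 * s - 1 - card rows \<le> card ({r<..<r + 3 * s} - rows)"
    using diff_card_le_card_Diff[OF fin(2), of "{r<..<r + 3 * s}"] by simp
  then have "2 * s \<le> card ({r<..<r + 3 * s} - rows)"
    using card(2) by linarith
  then obtain A where A: "A \<subseteq> {r<..<r + 3 * s} - rows" "card A = 2 * s"
    by (meson obtain_subset_with_card_n)
  obtain C where C: "is_cycle C" "subgraph_of C (grid (4 * s))" "card (edges C) = 4 * s * s + 12 * s"
    "card (edges C \<inter> seam s) = 1"
    "verts C \<subseteq> {pt i j | i j. i \<in> {c, c + s, c + 3 * s} \<or> j \<in> A \<union> {r, r + 3 * s}}"
    using comb_cycle[OF r(1) c(1), of A] A by blast
  have hit: "i \<in> cols" "j \<in> rows" if "pt i j \<in> Y" for i j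
    using that by (force simp: cols_def rows_def pt_def)+
  have "i \<notin> {c, c + s, c + 3 * s}" if "i \<in> cols" for i
    using that c(2)[of 0] c(2)[of 1] c(2)[of 3] by auto
  moreover have "j \<notin> A \<union> {r, r + 3 * s}" if "j \<in> rows" for j
    using that A(1) r(2)[of 0] r(2)[of 3] by auto
  ultimately have "verts C \<inter> Y = {}"
    using C(5) hit by blast
  then show ?thesis
    using C cycle_subgraph_delete_verts[OF C(1)] by blast
qed

section \<open>Choice of the weights\<close>

text \<open>Density zero yields a large \<open>n\<close> with few elements of \<open>L\<close> up to
  \<open>n\<close>. Moving on to the next element \<open>l\<close> of \<open>L\<close> adds none
  below \<open>l\<close>, and \<open>l\<close> exceeds \<open>n\<close>.\<close>

lemma sparse_below_element:
  assumes "lower_density L = 0" "infinite L"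
  shows "\<exists>l\<in>L. N \<le> l \<and> q * card (L \<inter> {1..<l}) < l"
proof -
  \<comment> \<open>\<open>Suc N\<close> instead of \<open>N\<close> keeps \<open>n\<close>
    positive, so that the quotient in the density is genuine.\<close>
  have "\<exists>n\<ge>Suc N. q * card (L \<inter> {1..n}) < n"
  proof (rule ccontr)
    assume "\<not> ?thesis"
    then have ge: "n \<le> q * card (L \<inter> {1..n})" if "Suc N \<le> n" for n
      using that by (meson not_le)
    then have "0 < q" using ge[of "Suc N"] by (cases q) auto
    have "ereal (1 / real q) \<le> ereal (real (card (L \<inter> {1..n})) / real n)" if "Suc N \<le> n" for n
    proof -
      have "real n \<le> real q * real (card (L \<inter> {1..n}))"
        using ge[OF that] by (metis of_nat_le_iff of_nat_mult)
      then show ?thesis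
        using \<open>0 < q\<close> that by (simp add: field_simps)
    qed
    then have "ereal (1 / real q) \<le> lower_density L"
      unfolding lower_density_def
      by (intro Liminf_bounded) (auto simp: eventually_sequentially)
    then show False using assms(1) \<open>0 < q\<close> by simp
  qed
  then obtain n where n: "Suc N \<le> n" "q * card (L \<inter> {1..n}) < n" by blast
  define l where "l = (LEAST l. l \<in> L \<and> n < l)"
  have "\<exists>l. l \<in> L \<and> n < l"
    using assms(2) by (auto simp: infinite_nat_iff_unbounded)
  then have l: "l \<in> L" "n < l"
    unfolding l_def by (metis (mono_tags, lifting) LeastI_ex)+
  have "x \<le> n" if "x \<in> L" "x < l" for x
    using that not_less_Least[of x "\<lambda>l. l \<in> L \<and> n < l"] by (auto simp: l_def)
  then have "L \<inter> {1..<l} = L \<inter> {1..n}"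
    using l(2) by auto
  then show ?thesis using l n by (intro bexI[of _ l]) auto
qed

text \<open>Counting over candidate pairs \<open>x z\<close>, \<open>y z\<close> with
  \<open>x z * J + y z = l\<close>: each pair of coefficients spoils at most as many candidates as
  \<open>L\<close> has elements below \<open>l\<close>, and sparsity leaves a candidate that no pair
  spoils. The bound on \<open>s * y\<close> limits the vertices spent on the seam.\<close>

lemma generic_weights:
  assumes "L \<subseteq> {1..}" "1 \<le> J" "1 \<le> s" "2 * s * J \<le> l"
    and sparse: "2 * s * J * (Suc A * Suc A) * card (L \<inter> {1..<l}) < l"
  shows "\<exists>x y. 1 \<le> x \<and> x * J + y = l \<and> s * y \<le> l \<and>
    (\<forall>a\<le>A. \<forall>b\<le>A. x * a + y * b \<in> L \<longrightarrow> l \<le> x * a + y * b)"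
proof -
  define K where "K = card (L \<inter> {1..<l})"
  \<comment> \<open>For \<open>z < Z\<close>, \<open>y z\<close> is at most
    \<open>(z + 1) * J\<close> and hence at most \<open>Z * J\<close>, which gives
    \<open>s * y z \<le> l\<close>; and \<open>Z \<le> l div J\<close> keeps the truncated
    subtraction in \<open>x z\<close> exact and positive.\<close>
  define Z where "Z = l div (s * J)"
  define x where "x z = l div J - z" for z
  define y where "y z = l mod J + z * J" for z
  have "Z \<le> l div J"
    unfolding Z_def using assms(2,3) by (intro div_le_mono2) auto
  then have x_eq: "int (x z) = int (l div J) - int z" and x_pos: "1 \<le> x z" if "z < Z" for z
    using that by (auto simp: x_def)
  have l_eq: "x z * J + y z = l" if "z < Z" for z
  proof -
    have "x z * J + y z = (l div J - z + z) * J + l mod J"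
      by (simp add: x_def y_def algebra_simps)
    also have "l div J - z + z = l div J" using that \<open>Z \<le> l div J\<close> by simp
    finally show ?thesis by simp
  qed
  have y_le: "s * y z \<le> l" if "z < Z" for z
  proof -
    have "y z \<le> Suc z * J"
      using assms(2) by (simp add: y_def less_imp_le)
    also have "\<dots> \<le> Z * J" using that by (intro mult_le_mono1) simp
    finally have "s * y z \<le> Z * (s * J)" by (simp add: algebra_simps)
    also have "\<dots> \<le> l" by (simp add: Z_def)
    finally show ?thesis .
  qed
  define bad where "bad a b = {z \<in> {..<Z}. x z * a + y z * b \<in> L \<inter> {1..<l}}" for a b
  have bad_card: "card (bad a b) \<le> K" for a b
  proof (cases "a = J * b")
    case True
    \<comment> \<open>The value is \<open>b * l\<close>, which is zero or at least \<open>l\<close>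
      and thus never in \<open>{1..<l}\<close>.\<close>
    have "z \<notin> bad a b" for z
    proof
      assume z: "z \<in> bad a b"
      then have "x z * a + y z * b = b * l"
        using l_eq[of z] by (auto simp: True bad_def algebra_simps simp flip: l_eq[of z])
      then show False using z by (cases b) (auto simp: bad_def)
    qed
    then have "bad a b = {}" by blast
    then show ?thesis by simp
  next
    case False
    have "inj_on (\<lambda>z. x z * a + y z * b) (bad a b)"
    proof (rule inj_onI)
      fix z z' assume z: "z \<in> bad a b" "z' \<in> bad a b" and eq: "x z * a + y z * b = x z' * a + y z' * b"
      have "int (x z) * int a + int (y z) * int b = int (x z') * int a + int (y z') * int b"
        using arg_cong[OF eq, of int] by simp
      \<comment> \<open>The value is affine in \<open>z\<close> with slope \<open>J * b - a\<close>;
        integers are used since the slope may be negative.\<close>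
      then have "(int z - int z') * (int J * int b - int a) = 0"
        using z by (simp add: x_eq y_def bad_def algebra_simps)
      moreover have "int J * int b - int a \<noteq> 0"
        using False by (metis eq_iff_diff_eq_0 of_nat_eq_iff of_nat_mult)
      ultimately show "z = z'" by simp
    qed
    then show ?thesis
      unfolding K_def by (intro card_inj_on_le) (auto simp: bad_def)
  qed
  have "card (\<Union>(a, b)\<in>{..A} \<times> {..A}. bad a b) \<le> (\<Sum>(a, b)\<in>{..A} \<times> {..A}. card (bad a b))"
    using card_UN_le[of "{..A} \<times> {..A}" "\<lambda>(a, b). bad a b"] by (simp add: case_prod_unfold)
  also have "\<dots> \<le> (\<Sum>(a, b)\<in>{..A} \<times> {..A}. K)"
    using bad_card by (intro sum_mono) auto
  also have "\<dots> = Suc A * Suc A * K" by simp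
  also have "\<dots> < Z"
  proof -
    have "2 * (s * J) * (Suc A * Suc A * K) < l"
      using sparse unfolding K_def by (simp only: mult.assoc)
    \<comment> \<open>Both hypotheses carry a factor 2: one half of \<open>l\<close> pays for the
      spoiled candidates, the other half for one more.\<close>
    then have "Suc (Suc A * Suc A * K) * (s * J) \<le> l"
      using assms(4) by (simp only: mult_Suc) (simp only: algebra_simps)
    then have "Suc (Suc A * Suc A * K) \<le> Z"
      unfolding Z_def using assms(2,3) by (subst less_eq_div_iff_mult_less_eq) auto
    then show ?thesis by simp
  qed
  finally have "card (\<Union>(a, b)\<in>{..A} \<times> {..A}. bad a b) < card {..<Z}" by simp
  then have "\<not> {..<Z} \<subseteq> (\<Union>(a, b)\<in>{..A} \<times> {..A}. bad a b)"
    using card_mono[of "\<Union>(a, b)\<in>{..A} \<times> {..A}. bad a b" "{..<Z}"] by (auto simp: bad_def)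
  then obtain z where z: "z < Z" "\<And>a b. a \<le> A \<Longrightarrow> b \<le> A \<Longrightarrow> z \<notin> bad a b" by blast
  have "l \<le> x z * a + y z * b" if "a \<le> A" "b \<le> A" "x z * a + y z * b \<in> L" for a b
  proof -
    have "x z * a + y z * b \<notin> {1..<l}"
      using z(1) z(2)[OF that(1,2)] that(3) by (simp add: bad_def)
    moreover have "1 \<le> x z * a + y z * b"
      using that(3) assms(1) by auto
    ultimately show ?thesis by simp
  qed
  then show ?thesis
    using x_pos[OF z(1)] l_eq[OF z(1)] y_le[OF z(1)]
    by (intro exI[of _ "x z"] exI[of _ "y z"] conjI allI impI)
qed

section \<open>Packing bound by double counting, and the final graphs\<close>

lemma packing_size_bound:
  assumes "finite V" "\<And>i. i < k \<Longrightarrow> S i \<subseteq> V" "\<And>i. i < k \<Longrightarrow> l \<le> card (S i)"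
    "\<And>v. v \<in> V \<Longrightarrow> card {i. i < k \<and> v \<in> S i} \<le> t"
  shows "k * l \<le> t * card V"
proof -
  have "k * l \<le> (\<Sum>i<k. card (S i))"
    using sum_mono[of "{..<k}" "\<lambda>_. l" "\<lambda>i. card (S i)"] assms(3) by simp
  also have "\<dots> = (\<Sum>i<k. \<Sum>v\<in>V. if v \<in> S i then 1 else 0)"
  proof (rule sum.cong[OF refl])
    fix i assume "i \<in> {..<k}"
    then have "V \<inter> S i = S i" using assms(2) by auto
    then show "card (S i) = (\<Sum>v\<in>V. if v \<in> S i then 1 else 0)"
      using assms(1) by (simp add: sum.If_cases)
  qed
  also have "\<dots> = (\<Sum>v\<in>V. \<Sum>i<k. if v \<in> S i then 1 else 0)"
    by (rule sum.swap)
  also have "\<dots> \<le> (\<Sum>v\<in>V. t)"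
  proof (rule sum_mono)
    fix v assume "v \<in> V"
    have "{..<k} \<inter> {i. v \<in> S i} = {i. i < k \<and> v \<in> S i}" by auto
    then show "(\<Sum>i<k. if v \<in> S i then 1 else 0) \<le> t"
      using assms(4)[OF \<open>v \<in> V\<close>] by (simp add: sum.If_cases)
  qed
  also have "\<dots> = t * card V" by simp
  finally show ?thesis .
qed

text \<open>The packing size \<open>13 * t + 1\<close> is independent of \<open>m\<close>, so every
  candidate for \<open>f\<close> fails at this one argument, with \<open>m\<close> chosen as its
  value there.\<close>

lemma no_packing_no_hitting_set:
  assumes "L \<subseteq> {1..}" "infinite L" "lower_density L = 0"
  shows "\<exists>G :: nat ugraph. finite_simple_graph G \<and> planar G \<and>
    \<not> has_packing L t (13 * t + 1) G \<and> \<not> has_hitting_set L m G"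
proof -
  \<comment> \<open>The combs survive the deletion of fewer than \<open>s\<close> vertices.\<close>
  define s where "s = Suc m"
  define J where "J = 4 * s * s + 12 * s"
  \<comment> \<open>The grid of side \<open>4 * s\<close> has at most
    \<open>2 * (4 * s) * (4 * s)\<close> edges, which bounds both the number of edges of a cycle and
    its number of seam edges.\<close>
  define A where "A = 32 * s * s"
  have s: "1 \<le> s" and J: "1 \<le> J" by (auto simp: s_def J_def)
  obtain l where l: "l \<in> L" "2 * s * J \<le> l" "2 * s * J * (Suc A * Suc A) * card (L \<inter> {1..<l}) < l"
    using sparse_below_element[OF assms(3,2)] by blast
  obtain x y where xy: "1 \<le> x" "x * J + y = l" "s * y \<le> l"
    "\<And>a b. a \<le> A \<Longrightarrow> b \<le> A \<Longrightarrow> x * a + y * b \<in> L \<Longrightarrow> l \<le> x * a + y * b"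
    using generic_weights[OF assms(1) J s l(2,3)] by blast
  define G where "G = grid (4 * s)"
  define w where "w e = (if e \<in> seam s then x + y else x)" for e
  have finG: "finite (edges G)"
    unfolding G_def by (rule finite_edges[OF finite_simple_grid])
  have card_G: "card (edges G) \<le> A" "card (verts G) \<le> 16 * s * s"
    using card_grid_edges[of "4 * s"] card_grid_verts[of "4 * s"] by (simp_all add: G_def A_def)
  have sum_w: "sum w F = x * card F + y * card (F \<inter> seam s)" if "finite F" for F
  proof -
    have "sum w F = (\<Sum>e\<in>F. x + (if e \<in> seam s then y else 0))"
      by (intro sum.cong) (auto simp: w_def)
    then show ?thesis using that by (simp add: sum.distrib sum.If_cases)
  qed
  have G_simple: "finite_simple_graph G" "planar G"
    by (simp_all add: G_def finite_simple_grid planar_grid)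
  have w_pos: "1 \<le> w e" for e
    using xy(1) by (simp add: w_def)
  obtain H :: "nat ugraph" where H: "finite_simple_graph H" "planar H"
    "card (verts H) = card (verts G) + (\<Sum>e\<in>edges G. w e - 1)"
    and H_cycle: "\<And>C. is_cycle C \<Longrightarrow> subgraph_of C H \<Longrightarrow>
      \<exists>D. is_cycle D \<and> subgraph_of D G \<and> card (edges C) = sum w (edges D)"
    and H_del: "\<And>X. X \<subseteq> verts H \<Longrightarrow> \<exists>Y \<subseteq> verts G. card Y \<le> card X \<and>
      (\<forall>D. is_cycle D \<and> subgraph_of D (delete_verts G Y) \<longrightarrow>
        (\<exists>C. is_cycle C \<and> subgraph_of C (delete_verts H X) \<and> card (edges C) = sum w (edges D)))"
    using weighted_subdivision[of G w, OF G_simple w_pos] by auto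
  have long: "l \<le> card (verts C)" if C: "L_cycle_in L H C" for C
  proof -
    have cyc: "is_cycle C" "subgraph_of C H" "card (edges C) \<in> L"
      using C by (auto simp: L_cycle_in_def)
    obtain D where D: "subgraph_of D G" "card (edges C) = sum w (edges D)"
      using H_cycle[OF cyc(1,2)] by blast
    have sub: "edges D \<subseteq> edges G" using D(1) by (simp add: subgraph_of_def)
    have fin: "finite (edges D)" using sub finG finite_subset by blast
    have "card (edges D) \<le> A" "card (edges D \<inter> seam s) \<le> A"
      using card_mono[OF finG sub] card_mono[OF fin, of "edges D \<inter> seam s"] card_G(1) by auto
    then have "l \<le> card (edges C)"
      using xy(4) cyc(3) D(2) sum_w[OF fin] by simp
    then show ?thesis using is_cycle_card(1)[OF cyc(1)] by simp
  qed
  \<comment> \<open>13 = 4 + 8 + 1: at most \<open>4 * (x * J)\<close> for the grid vertices,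
    \<open>8 * (x * J)\<close> for the weight \<open>x\<close> on all edges, and
    \<open>s * y \<le> l\<close> for the seam.\<close>
  have card_H: "card (verts H) \<le> 13 * l"
  proof -
    have "seam s = (\<lambda>i. {pt i (s - 1), pt i s}) ` {..<s}"
      by (auto simp: seam_def)
    then have "card (edges G \<inter> seam s) \<le> s"
      using card_image_le[of "{..<s}" "\<lambda>i. {pt i (s - 1), pt i s}"]
        card_mono[of "seam s" "edges G \<inter> seam s"] by simp
    then have "y * card (edges G \<inter> seam s) \<le> y * s"
      by (rule mult_le_mono2)
    moreover have "(\<Sum>e\<in>edges G. w e - 1) \<le> sum w (edges G)"
      by (intro sum_mono) simp
    ultimately have "card (verts H) \<le> 16 * s * s + (x * card (edges G) + y * s)"
      using H(3) card_G(2) sum_w[OF finG] by linarith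
    also have "x * card (edges G) \<le> x * (8 * J)"
      using card_G(1) by (intro mult_le_mono2) (simp add: A_def J_def)
    also have "16 * s * s \<le> 4 * (x * J)"
    proof -
      have "1 * J \<le> x * J" using xy(1) by (intro mult_le_mono1)
      moreover have "16 * s * s \<le> 4 * J" by (simp add: J_def)
      ultimately show ?thesis by linarith
    qed
    finally show ?thesis using xy(2,3) by (simp add: mult.commute)
  qed
  have "\<not> has_packing L t (13 * t + 1) H"
  proof
    assume "has_packing L t (13 * t + 1) H"
    then obtain C where C: "\<And>i. i < 13 * t + 1 \<Longrightarrow> L_cycle_in L H (C i)"
      "\<And>v. v \<in> verts H \<Longrightarrow> card {i. i < 13 * t + 1 \<and> v \<in> verts (C i)} \<le> t"
      by (auto simp: has_packing_def)
    have "(13 * t + 1) * l \<le> t * card (verts H)"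
      using H(1) C long by (intro packing_size_bound[of _ _ "\<lambda>i. verts (C i)"])
        (auto simp: finite_simple_graph_def L_cycle_in_def subgraph_of_def)
    also have "\<dots> \<le> t * (13 * l)" using card_H by (rule mult_le_mono2)
    finally have "l = 0" by (simp add: algebra_simps)
    then show False using l(1) assms(1) by auto
  qed
  moreover have "\<not> has_hitting_set L m H"
  proof
    assume "has_hitting_set L m H"
    then obtain X where X: "X \<subseteq> verts H" "card X \<le> m" "\<And>C. \<not> L_cycle_in L (delete_verts H X) C"
      by (auto simp: has_hitting_set_def)
    obtain Y where Y: "Y \<subseteq> verts G" "card Y \<le> card X"
      "\<And>D. is_cycle D \<Longrightarrow> subgraph_of D (delete_verts G Y) \<Longrightarrow>
        \<exists>C. is_cycle C \<and> subgraph_of C (delete_verts H X) \<and> card (edges C) = sum w (edges D)"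
      using H_del[OF X(1)] by auto
    obtain D where D: "is_cycle D" "subgraph_of D (delete_verts G Y)" "card (edges D) = J"
      "card (edges D \<inter> seam s) = 1"
      using comb_cycle_avoiding[of Y s] Y(1,2) X(2) by (auto simp: G_def s_def J_def)
    \<comment> \<open>Infinite sets have cardinality 0, so the positive value \<open>J\<close>
      forces finiteness.\<close>
    have "finite (edges D)" using D(3) J card.infinite by fastforce
    then have w_D: "sum w (edges D) = l" using sum_w D(3,4) xy(2) by simp
    obtain C where "is_cycle C" "subgraph_of C (delete_verts H X)" "card (edges C) = sum w (edges D)"
      using Y(3)[OF D(1,2)] by blast
    then have "L_cycle_in L (delete_verts H X) C"
      using w_D l(1) by (simp add: L_cycle_in_def)
    then show False using X(3) by blast
  qed
  ultimately show ?thesis using H(1,2) by blast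
qed

theorem theorem1p3:
  fixes L :: "nat set" and t :: nat
  assumes "L \<subseteq> {1..}" and "infinite L" and "lower_density L = 0" and "t \<ge> 1"
  shows "\<not> erdos_posa L t {G :: nat ugraph. finite_simple_graph G \<and> planar G}"
proof
  assume "erdos_posa L t {G :: nat ugraph. finite_simple_graph G \<and> planar G}"
  then obtain f where f: "\<And>k G. 1 \<le> k \<Longrightarrow> finite_simple_graph G \<Longrightarrow> planar G \<Longrightarrow>
      has_packing L t k G \<or> has_hitting_set L (f k) (G :: nat ugraph)"
    by (auto simp: erdos_posa_def)
  obtain G :: "nat ugraph" where "finite_simple_graph G" "planar G"
    "\<not> has_packing L t (13 * t + 1) G" "\<not> has_hitting_set L (f (13 * t + 1)) G"
    using no_packing_no_hitting_set[OF assms(1-3)] by blast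
  then show False using f[of "13 * t + 1" G] by simp
qed

end
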